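(* Let $T_1,T_2,S_1,S_2\in\mathcal{B}_A(\mathcal{H})$, let $\mathbb{T}=\begin{bmatrix} 0& T_1\\ T_2& 0\end{bmatrix}$ and $\mathbb{S}=\begin{bmatrix} 0& S_1\\ S_2& 0\end{bmatrix}$ on $\mathcal{H}\oplus\mathcal{H}$, and let $\beta\ge 0$. Then for all $r\ge 1$, $$\omega_{\mathbb{A}}^{4r}\left(\mathbb{S}^{\sharp_{\mathbb{A}}}\mathbb{T}\right)\le \frac{1+2\beta}{8(\beta+1)}\max\{\phi_r^2,\psi_r^2\}+\frac{1}{2(\beta+1)}\max\{\rho_r^2,\theta_r^2\},$$ where $\phi_r=\|(T_2^{\sharp_A}T_2)^{2r}+(S_2^{\sharp_A}S_2)^{2r}\|_A$, $\psi_r=\|(T_1^{\sharp_A}T_1)^{2r}+(S_1^{\sharp_A}S_1)^{2r}\|_A$, $\rho_r=\omega_A^{r}(S_2^{\sharp_A}S_2T_2^{\sharp_A}T_2)$ and $\theta_r=\omega_A^{r}(S_1^{\sharp_A}S_1T_1^{\sharp_A}T_1)$.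
   Context: $\mathcal{H}$ is a complex Hilbert space, $\mathcal{B}(\mathcal{H})$ the bounded linear operators on it, and $A\in\mathcal{B}(\mathcal{H})$ is a fixed positive (semidefinite) operator. Put $\langle x,y\rangle_A=\langle Ax,y\rangle$ and $\|x\|_A=\langle x,x\rangle_A^{1/2}$. $\mathcal{B}_A(\mathcal{H})$ is the set of $T\in\mathcal{B}(\mathcal{H})$ for which there is $S\in\mathcal{B}(\mathcal{H})$ with $AS=T^*A$; for such $T$, $T^{\sharp_A}=A^\dagger T^*A$ ($A^\dagger$ the Moore-Penrose inverse), i.e. the unique bounded solution $S$ of $AS=T^*A$ with range in $\overline{\mathrm{ran}(A)}$. The $A$-operator seminorm is $\|T\|_A=\sup\{\|Tx\|_A/\|x\|_A : x\in\overline{\mathrm{ran}(A)},\ x\ne 0\}$, and the $A$-numerical radius is $\omega_A(T)=\sup\{|\langle Tx,x\rangle_A| : x\in\mathcal{H},\ \|x\|_A=1\}$. On $\mathcal{H}\oplus\mathcal{H}$ let $\mathbb{A}=\begin{bmatrix}A&0\\0&A\end{bmatrix}$, and put $\langle z,w\rangle_{\mathbb{A}}=\langle \mathbb{A}z,w\rangle$ and $\|z\|_{\mathbb{A}}=\langle z,z\rangle_{\mathbb{A}}^{1/2}$ for $z,w\in\mathcal{H}\oplus\mathcal{H}$. For a bounded operator $\mathbb{X}$ on $\mathcal{H}\oplus\mathcal{H}$ whose entries lie in $\mathcal{B}_A(\mathcal{H})$, $\mathbb{X}^{\sharp_{\mathbb{A}}}=\mathbb{A}^\dagger\mathbb{X}^*\mathbb{A}$,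 i.e. the unique bounded solution $\mathbb{Y}$ of $\mathbb{A}\mathbb{Y}=\mathbb{X}^*\mathbb{A}$ with range in $\overline{\mathrm{ran}(\mathbb{A})}$, and $\omega_{\mathbb{A}}(\mathbb{X})=\sup\{|\langle \mathbb{X}z,z\rangle_{\mathbb{A}}| : z\in\mathcal{H}\oplus\mathcal{H},\ \|z\|_{\mathbb{A}}=1\}$. $\omega_A^s(T)$ means $(\omega_A(T))^s$, and $\omega_{\mathbb{A}}^s(\mathbb{X})$ means $(\omega_{\mathbb{A}}(\mathbb{X}))^s$. Powers: an operator $S\in\mathcal{B}_A(\mathcal{H})$ is $A$-positive if $AS\ge 0$ (e.g. $T^{\sharp_A}T$ and $TT^{\sharp_A}$). Every $S\in\mathcal{B}_A(\mathcal{H})$ induces a bounded operator $\tilde S$ on the Hilbert space completion of $\mathcal{H}/\ker A$ under $\langle\cdot,\cdot\rangle_A$, with $\|\tilde S\|=\|S\|_A$, and $\tilde S\ge 0$ if $S$ is $A$-positive; for real $s>0$ and $A$-positive $S,R$, $\|S^s+R^s\|_A$ means $\|\tilde S^s+\tilde R^s\|$ (for integer $s$ this is the seminorm of the ordinary sum of powers). *)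

theory Defs
  imports "HOL-Analysis.Analysis" "HOL-Computational_Algebra.Polynomial"
begin

text \<open>
  Complex Hilbert spaces, over the library's real ones: the norm and the topology come from
  \<open>real_inner\<close>, and the real inner product is the real part of the complex one.
  The complex inner product is linear in its \<^emph>\<open>first\<close> argument.
\<close>

class complex_hilbert_space = real_inner + complete_space +
  fixes scaleC :: "complex \<Rightarrow> 'a \<Rightarrow> 'a" (infixr "*\<^sub>C" 75)
    and cinner :: "'a \<Rightarrow> 'a \<Rightarrow> complex"
  assumes scaleC_add_right: "c *\<^sub>C (x + y) = c *\<^sub>C x + c *\<^sub>C y"
    and scaleC_add_left: "(b + c) *\<^sub>C x = b *\<^sub>C x + c *\<^sub>C x"
    and scaleC_scaleC: "b *\<^sub>C c *\<^sub>C x = (b * c) *\<^sub>C x"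
    and scaleR_scaleC: "r *\<^sub>R x = complex_of_real r *\<^sub>C x"
    and cinner_commute: "cinner x y = cnj (cinner y x)"
    and cinner_add_left: "cinner (x + y) z = cinner x z + cinner y z"
    and cinner_scaleC_left: "cinner (c *\<^sub>C x) y = c * cinner x y"
    and inner_eq_Re_cinner: "inner x y = Re (cinner x y)"

instantiation prod :: (complex_hilbert_space, complex_hilbert_space) complex_hilbert_space
begin

definition scaleC_prod :: "complex \<Rightarrow> 'a \<times> 'b \<Rightarrow> 'a \<times> 'b" where
  "scaleC_prod c z = (c *\<^sub>C fst z, c *\<^sub>C snd z)"

definition cinner_prod :: "'a \<times> 'b \<Rightarrow> 'a \<times> 'b \<Rightarrow> complex" where
  "cinner_prod z w = cinner (fst z) (fst w) + cinner (snd z) (snd w)"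

instance
proof
  fix x y z :: "'a \<times> 'b" and b c :: complex and r :: real
  show "c *\<^sub>C (x + y) = c *\<^sub>C x + c *\<^sub>C y"
    by (simp add: scaleC_prod_def scaleC_add_right)
  show "(b + c) *\<^sub>C x = b *\<^sub>C x + c *\<^sub>C x"
    by (simp add: scaleC_prod_def scaleC_add_left)
  show "b *\<^sub>C c *\<^sub>C x = (b * c) *\<^sub>C x"
    by (simp add: scaleC_prod_def scaleC_scaleC)
  show "r *\<^sub>R x = complex_of_real r *\<^sub>C x"
    by (simp add: scaleC_prod_def scaleR_prod_def scaleR_scaleC)
  show "cinner x y = cnj (cinner y x)"
    by (simp add: cinner_prod_def cinner_commute[symmetric])
  show "cinner (x + y) z = cinner x z + cinner y z"
    by (simp add: cinner_prod_def cinner_add_left)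
  show "cinner (c *\<^sub>C x) y = c * cinner x y"
    by (simp add: cinner_prod_def scaleC_prod_def cinner_scaleC_left distrib_left)
  show "inner x y = Re (cinner x y)"
    by (simp add: cinner_prod_def inner_prod_def inner_eq_Re_cinner)
qed

end

definition bounded_clinear ::
  "('a::complex_hilbert_space \<Rightarrow> 'b::complex_hilbert_space) \<Rightarrow> bool" where
  "bounded_clinear T \<longleftrightarrow> bounded_linear T \<and> (\<forall>c x. T (c *\<^sub>C x) = c *\<^sub>C T x)"

definition cadjoint ::
  "('a::complex_hilbert_space \<Rightarrow> 'b::complex_hilbert_space) \<Rightarrow> 'b \<Rightarrow> 'a" where
  "cadjoint T = (THE S. \<forall>x y. cinner (T x) y = cinner x (S y))"

definition positive_op :: "('a::complex_hilbert_space \<Rightarrow> 'a) \<Rightarrow> bool" where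
  "positive_op A \<longleftrightarrow> bounded_clinear A \<and>
     (\<forall>x. cinner (A x) x \<in> \<real> \<and> 0 \<le> Re (cinner (A x) x))"


subsection \<open>The semi-Hilbertian structure of a positive operator \<open>A\<close>\<close>

definition A_inner :: "('a::complex_hilbert_space \<Rightarrow> 'a) \<Rightarrow> 'a \<Rightarrow> 'a \<Rightarrow> complex" where
  "A_inner A x y = cinner (A x) y"

definition A_norm :: "('a::complex_hilbert_space \<Rightarrow> 'a) \<Rightarrow> 'a \<Rightarrow> real" where
  "A_norm A x = sqrt (Re (A_inner A x x))"

definition B_A :: "('a::complex_hilbert_space \<Rightarrow> 'a) \<Rightarrow> ('a \<Rightarrow> 'a) set" where
  "B_A A = {T. bounded_clinear T \<and> (\<exists>S. bounded_clinear S \<and> A \<circ> S = cadjoint T \<circ> A)}"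

definition A_adjoint :: "('a::complex_hilbert_space \<Rightarrow> 'a) \<Rightarrow> ('a \<Rightarrow> 'a) \<Rightarrow> 'a \<Rightarrow> 'a" where
  "A_adjoint A T = (THE S. bounded_clinear S \<and> A \<circ> S = cadjoint T \<circ> A \<and>
     range S \<subseteq> closure (range A))"

text \<open>
  The inserted \<open>0\<close> only fixes the supremum of the empty set, which occurs exactly for
  \<open>A = 0\<close>: the supremum is taken in the nonnegative reals.
\<close>

definition A_numerical_radius :: "('a::complex_hilbert_space \<Rightarrow> 'a) \<Rightarrow> ('a \<Rightarrow> 'a) \<Rightarrow> real" where
  "A_numerical_radius A T = Sup (insert 0 {cmod (A_inner A (T x) x) | x. A_norm A x = 1})"

definition block_op ::
  "('a \<Rightarrow> 'c) \<Rightarrow> ('b \<Rightarrow> 'c) \<Rightarrow> ('a \<Rightarrow> 'd) \<Rightarrow> ('b \<Rightarrow> 'd) \<Rightarrow> 'a \<times> 'b \<Rightarrow> 'c::plus \<times> 'd::plus" where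
  "block_op T11 T12 T21 T22 = (\<lambda>(x, y). (T11 x + T12 y, T21 x + T22 y))"


subsection \<open>Real powers of positive operators\<close>

definition poly_op :: "real poly \<Rightarrow> ('a::complex_hilbert_space \<Rightarrow> 'a) \<Rightarrow> 'a \<Rightarrow> 'a" where
  "poly_op p P x = (\<Sum>i\<le>degree p. coeff p i *\<^sub>R (P ^^ i) x)"

text \<open>
  The continuous functional calculus of a positive bounded operator \<open>P\<close>, whose spectrum lies in
  \<open>[0, \<parallel>P\<parallel>]\<close>: \<open>f(P)\<close> is the limit in operator norm of \<open>p\<^sub>n(P)\<close> for all polynomials
  \<open>p\<^sub>n\<close> tending to \<open>f\<close> uniformly on \<open>[0, \<parallel>P\<parallel>]\<close>.
\<close>

definition functional_calculus ::
  "(real \<Rightarrow> real) \<Rightarrow> ('a::complex_hilbert_space \<Rightarrow> 'a) \<Rightarrow> 'a \<Rightarrow> 'a" where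
  "functional_calculus f P = (THE Q. bounded_clinear Q \<and>
     (\<forall>p. uniform_limit {0..onorm P} (\<lambda>n. poly (p n)) f sequentially \<longrightarrow>
        (\<lambda>n. onorm (\<lambda>x. poly_op (p n) P x - Q x)) \<longlonglongrightarrow> 0))"

definition op_powr :: "('a::complex_hilbert_space \<Rightarrow> 'a) \<Rightarrow> real \<Rightarrow> 'a \<Rightarrow> 'a" where
  "op_powr P s = functional_calculus (\<lambda>t. t powr s) P"


subsection \<open>The completion of \<open>H / ker A\<close>\<close>

text \<open>
  A map \<open>J\<close> into a Hilbert space with \<open>\<langle>J x, J y\<rangle> = \<langle>x, y\<rangle>\<^sub>A\<close> has kernel \<open>ker A\<close> and induces an
  isometry of \<open>H / ker A\<close> onto \<open>range J\<close>, so \<open>closure (range J)\<close> is the Hilbert space completion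
  of \<open>H / ker A\<close>, unique up to unitary equivalence. Such \<open>J\<close> exist with values in \<open>H\<close> itself,
  for instance the square root of \<open>A\<close>.
\<close>

definition is_completion_map ::
  "('a::complex_hilbert_space \<Rightarrow> 'a) \<Rightarrow> ('a \<Rightarrow> 'b::complex_hilbert_space) \<Rightarrow> bool" where
  "is_completion_map A J \<longleftrightarrow> bounded_clinear J \<and> (\<forall>x y. cinner (J x) (J y) = A_inner A x y)"

definition completion_map :: "('a::complex_hilbert_space \<Rightarrow> 'a) \<Rightarrow> 'a \<Rightarrow> 'a" where
  "completion_map A = (SOME J. is_completion_map A J)"

text \<open>
  The operator induced by \<open>S\<close> on \<open>K = closure (range J)\<close>, extended by \<open>0\<close> to the orthogonal
  complement of \<open>K\<close> so that it is an operator on the whole type. The extension has the same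
  norm, and it commutes with sums and with powers of positive exponent.
\<close>

definition induced_op :: "('a::complex_hilbert_space \<Rightarrow> 'a) \<Rightarrow> ('a \<Rightarrow> 'a) \<Rightarrow> 'a \<Rightarrow> 'a" where
  "induced_op A S = (THE P. bounded_clinear P \<and>
     (\<forall>x. P (completion_map A x) = completion_map A (S x)) \<and>
     (\<forall>y. (\<forall>x. cinner (completion_map A x) y = 0) \<longrightarrow> P y = 0))"

text \<open>\<open>\<parallel>S\<^sup>s + R\<^sup>s\<parallel>\<^sub>A\<close> for \<open>A\<close>-positive \<open>S\<close>, \<open>R\<close> and \<open>s > 0\<close>.\<close>

definition A_norm_powr_sum ::
  "('a::complex_hilbert_space \<Rightarrow> 'a) \<Rightarrow> real \<Rightarrow> ('a \<Rightarrow> 'a) \<Rightarrow> ('a \<Rightarrow> 'a) \<Rightarrow> real" where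
  "A_norm_powr_sum A s S R =
     onorm (\<lambda>x. op_powr (induced_op A S) s x + op_powr (induced_op A R) s x)"

end

theory Submission
  imports Defs "HOL-Computational_Algebra.Fundamental_Theorem_Algebra"
begin

text \<open>
  Since \<open>SS\<^sup># TT\<close> is block diagonal with blocks \<open>S2\<^sup># T2\<close> and \<open>S1\<^sup># T1\<close>, it suffices to bound
  \<open>|\<langle>T x, S x\<rangle>\<^sub>A|\<close> for one pair \<open>T, S\<close> and \<open>\<parallel>x\<parallel>\<^sub>A = 1\<close>. Let \<open>P, Q\<close> be the operators induced by
  \<open>T\<^sup># T\<close> and \<open>S\<^sup># S\<close> on the completion and \<open>e\<close> the image of \<open>x\<close>. By Cauchy-Schwarz
  \<open>|\<langle>T x, S x\<rangle>\<^sub>A|\<^sup>2 \<le> a\<close> with \<open>a = \<langle>P e, e\<rangle> \<langle>Q e, e\<rangle>\<close>, and Buzano's inequality gives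
  \<open>a \<le> (u v + w) / 2\<close> with \<open>u = \<parallel>P e\<parallel>\<close>, \<open>v = \<parallel>Q e\<parallel>\<close>, \<open>w = |\<langle>P e, Q e\<rangle>| \<le> u v\<close>. By convexity, the
  \<open>2r\<close>-th power of \<open>a\<close> is at most \<open>((u v)\<^bsup>2r\<^esup> + w\<^bsup>2r\<^esup>) / 2\<close>, and trivially at most \<open>(u v)\<^bsup>2r\<^esup>\<close>; the
  parameter \<open>\<beta>\<close> is the weight in a convex combination of the two bounds. Finally
  \<open>4 (u v)\<^bsup>2r\<^esup> \<le> (u\<^bsup>2r\<^esup> + v\<^bsup>2r\<^esup>)\<^sup>2 \<le> \<phi>\<^sup>2\<close> by McCarthy's inequality \<open>\<parallel>P e\<parallel>\<^bsup>2r\<^esup> \<le> \<langle>P\<^bsup>2r\<^esup> e, e\<rangle>\<close>, and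
  \<open>w\<^bsup>r\<^esup> \<le> \<rho>\<close>.
\<close>

section \<open>Complex Hilbert spaces\<close>

lemma scaleC_one [simp]: "1 *\<^sub>C x = x"
  using scaleR_scaleC[of 1 x] by simp

lemma scaleC_zero_left [simp]: "0 *\<^sub>C x = 0"
  using scaleR_scaleC[of 0 x] by simp

lemma scaleC_zero_right [simp]: "c *\<^sub>C (0::'a::complex_hilbert_space) = 0"
  using scaleC_add_right[of c 0 "0::'a"] by simp

lemma scaleC_minus_right: "c *\<^sub>C (- x) = - (c *\<^sub>C x)"
  using scaleC_add_right[of c x "-x"] by (simp add: eq_neg_iff_add_eq_0 add.commute)

lemma scaleC_diff_right: "c *\<^sub>C (x - y) = c *\<^sub>C x - c *\<^sub>C y"
  using scaleC_add_right[of c x "-y"] by (simp add: scaleC_minus_right)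

lemma scaleC_sum_right: "c *\<^sub>C (\<Sum>i\<in>I. f i) = (\<Sum>i\<in>I. c *\<^sub>C f i)"
  by (induction I rule: infinite_finite_induct) (auto simp: scaleC_add_right)

lemma scaleC_scaleR: "c *\<^sub>C r *\<^sub>R x = r *\<^sub>R c *\<^sub>C x"
  by (simp add: scaleR_scaleC scaleC_scaleC mult.commute)

lemma cinner_add_right: "cinner x (y + z) = cinner x y + cinner x z"
  by (metis cinner_add_left cinner_commute complex_cnj_add)

lemma cinner_scaleC_right: "cinner x (c *\<^sub>C y) = cnj c * cinner x y"
  by (metis cinner_scaleC_left cinner_commute complex_cnj_mult)

lemma cinner_zero_left [simp]: "cinner 0 y = 0"
  using cinner_add_left[of 0 0 y] by simp

lemma cinner_zero_right [simp]: "cinner x 0 = 0"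
  using cinner_add_right[of x 0 0] by simp

lemma cinner_minus_left: "cinner (- x) y = - cinner x y"
  using cinner_add_left[of x "-x" y] by (simp add: eq_neg_iff_add_eq_0 add.commute)

lemma cinner_minus_right: "cinner x (- y) = - cinner x y"
  using cinner_add_right[of x y "-y"] by (simp add: eq_neg_iff_add_eq_0 add.commute)

lemma cinner_diff_left: "cinner (x - y) z = cinner x z - cinner y z"
  using cinner_add_left[of x "-y" z] by (simp add: cinner_minus_left)

lemma cinner_diff_right: "cinner x (y - z) = cinner x y - cinner x z"
  using cinner_add_right[of x y "-z"] by (simp add: cinner_minus_right)

lemma cinner_scaleR_left: "cinner (r *\<^sub>R x) y = of_real r * cinner x y"
  by (simp add: scaleR_scaleC cinner_scaleC_left)

lemma cinner_scaleR_right: "cinner x (r *\<^sub>R y) = of_real r * cinner x y"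
  by (simp add: scaleR_scaleC cinner_scaleC_right)

lemma cinner_sum_left: "cinner (\<Sum>i\<in>I. f i) y = (\<Sum>i\<in>I. cinner (f i) y)"
  by (induction I rule: infinite_finite_induct) (auto simp: cinner_add_left)

lemma cinner_sum_right: "cinner x (\<Sum>i\<in>I. f i) = (\<Sum>i\<in>I. cinner x (f i))"
  by (induction I rule: infinite_finite_induct) (auto simp: cinner_add_right)

lemma cinner_self: "cinner x x = of_real ((norm x)\<^sup>2)"
proof -
  have "Im (cinner x x) = 0"
    using cinner_commute[of x x] by (simp add: complex_eq_iff)
  then show ?thesis
    by (simp add: complex_eq_iff power2_norm_eq_inner inner_eq_Re_cinner)
qed

lemma Im_cinner: "Im (cinner x y) = inner x (\<i> *\<^sub>C y)"
  by (simp add: inner_eq_Re_cinner cinner_scaleC_right)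

text \<open>Recovers the complex inner product from the real one, so that facts about real
  orthogonality yield complex ones.\<close>

lemma cinner_eq_inner: "cinner x y = Complex (inner x y) (inner x (\<i> *\<^sub>C y))"
  by (simp add: complex_eq_iff Im_cinner) (simp add: inner_eq_Re_cinner)

lemma norm_scaleC [simp]: "norm (c *\<^sub>C x) = cmod c * norm x"
proof -
  have "cinner (c *\<^sub>C x) (c *\<^sub>C x) = of_real ((cmod c * norm x)\<^sup>2)"
    unfolding cinner_scaleC_left cinner_scaleC_right cinner_self[of x] power_mult_distrib
    by (simp add: complex_norm_square mult.commute flip: of_real_power)
  then have "(norm (c *\<^sub>C x))\<^sup>2 = (cmod c * norm x)\<^sup>2"
    by (metis cinner_self of_real_eq_iff)
  then show ?thesis by simp
qed

lemma norm_cinner_le: "cmod (cinner x y) \<le> norm x * norm y"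
proof (cases "cinner x y = 0")
  case False
  \<comment> \<open>A unimodular factor that turns the inner product into its modulus, which reduces
    the claim to the real Cauchy-Schwarz inequality.\<close>
  define c where "c = cnj (cinner x y) / of_real (cmod (cinner x y))"
  have "c * cinner x y = of_real (cmod (cinner x y))"
    using False complex_norm_square[of "cinner x y"]
    by (simp add: c_def divide_simps power2_eq_square mult.commute)
  then have "cmod (cinner x y) = inner (c *\<^sub>C x) y"
    by (simp add: inner_eq_Re_cinner cinner_scaleC_left)
  also have "\<dots> \<le> norm (c *\<^sub>C x) * norm y"
    using norm_cauchy_schwarz by blast
  also have "cmod c = 1" using False by (simp add: c_def norm_divide)
  then have "norm (c *\<^sub>C x) * norm y = norm x * norm y" by simp
  finally show ?thesis .
qed simp

lemma bounded_bilinear_cinner: "bounded_bilinear cinner"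
proof
  show "\<exists>K. \<forall>a b. cmod (cinner a b) \<le> norm a * norm b * K"
    using norm_cinner_le by (intro exI[of _ 1]) auto
qed (auto simp: cinner_add_left cinner_add_right cinner_scaleR_left cinner_scaleR_right
    scaleR_conv_of_real)

lemmas tendsto_cinner [tendsto_intros] = bounded_bilinear.tendsto[OF bounded_bilinear_cinner]

lemma bounded_clinear_const_scaleC: "bounded_clinear ((*\<^sub>C) c)"
  unfolding bounded_clinear_def
proof
  show "bounded_linear ((*\<^sub>C) c)"
    by (rule bounded_linear_intro[of _ "cmod c"])
      (auto simp: scaleC_add_right scaleC_scaleR mult.commute)
qed (simp add: scaleC_scaleC mult.commute)

lemma tendsto_scaleC [tendsto_intros]:
  "(f \<longlongrightarrow> l) F \<Longrightarrow> ((\<lambda>x. c *\<^sub>C f x) \<longlongrightarrow> c *\<^sub>C l) F"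
  using bounded_clinear_const_scaleC[of c] unfolding bounded_clinear_def
  by (auto intro: bounded_linear.tendsto)

lemma cinner_ext: "(\<And>z. cinner x z = cinner y z) \<Longrightarrow> x = y"
  using cinner_self[of "x - y"] by (auto simp: cinner_diff_left)

lemma cinner_ext_right: "(\<And>z. cinner z x = cinner z y) \<Longrightarrow> x = y"
  using cinner_self[of "x - y"] by (auto simp: cinner_diff_right)

subsection \<open>Bounded operators\<close>

lemma bounded_clinearD:
  assumes "bounded_clinear T"
  shows bounded_clinear_bounded_linear: "bounded_linear T"
    and bounded_clinear_linear: "linear T"
    and bounded_clinear_add: "T (x + y) = T x + T y"
    and bounded_clinear_diff: "T (x - y) = T x - T y"
    and bounded_clinear_zero: "T 0 = 0"
    and bounded_clinear_scaleC: "T (c *\<^sub>C x) = c *\<^sub>C T x"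
    and bounded_clinear_scaleR: "T (r *\<^sub>R x) = r *\<^sub>R T x"
    and bounded_clinear_sum: "T (\<Sum>i\<in>I. f i) = (\<Sum>i\<in>I. T (f i))"
    and norm_bounded_clinear_le: "norm (T x) \<le> onorm T * norm x"
  using assms unfolding bounded_clinear_def
  by (auto simp: bounded_linear.linear linear_add linear_diff linear_0 linear_scale
      linear_sum intro: onorm)

lemma bounded_clinearI:
  assumes "\<And>x y. T (x + y) = T x + T y" "\<And>c x. T (c *\<^sub>C x) = c *\<^sub>C T x"
    "\<And>x. norm (T x) \<le> norm x * K"
  shows "bounded_clinear T"
  unfolding bounded_clinear_def
  using assms by (auto intro!: bounded_linear_intro simp: scaleR_scaleC)

lemma bounded_clinear_compose:
  "bounded_clinear S \<Longrightarrow> bounded_clinear T \<Longrightarrow> bounded_clinear (S \<circ> T)"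
  unfolding bounded_clinear_def comp_def by (auto intro: bounded_linear_compose)

lemma bounded_clinear_plus:
  "bounded_clinear S \<Longrightarrow> bounded_clinear T \<Longrightarrow> bounded_clinear (\<lambda>x. S x + T x)"
  unfolding bounded_clinear_def by (auto intro: bounded_linear_add simp: scaleC_add_right)

lemma onorm_nonneg: "bounded_clinear T \<Longrightarrow> 0 \<le> onorm T"
  by (simp add: bounded_clinear_bounded_linear onorm_pos_le)

subsection \<open>Orthogonal projection and adjoints\<close>

lemma parallelogram: "(norm (x + y))\<^sup>2 + (norm (x - y))\<^sup>2 = 2 * (norm x)\<^sup>2 + 2 * (norm y)\<^sup>2"
  for x y :: "'a::real_inner"
  by (simp add: power2_norm_eq_inner inner_add_left inner_add_right inner_diff_left
      inner_diff_right inner_commute)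

text \<open>A minimizing sequence in \<open>K\<close> is Cauchy by the parallelogram law, and
  completeness together with closedness puts its limit in \<open>K\<close>.\<close>

lemma exists_nearest_point:
  fixes K :: "'a::{real_inner, complete_space} set"
  assumes "closed K" "subspace K"
  shows "\<exists>k\<in>K. \<forall>y\<in>K. norm (x - k) \<le> norm (x - y)"
proof -
  define d where "d = (INF y\<in>K. (norm (x - y))\<^sup>2)"
  have ne: "K \<noteq> {}" using subspace_0[OF assms(2)] by auto
  have bdd: "bdd_below ((\<lambda>y. (norm (x - y))\<^sup>2) ` K)"
    by (rule bdd_belowI[of _ 0]) auto
  have d_le: "d \<le> (norm (x - y))\<^sup>2" if "y \<in> K" for y
    unfolding d_def using bdd that by (rule cINF_lower)
  have "\<exists>y\<in>K. (norm (x - y))\<^sup>2 < d + inverse (Suc n)" for n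
  proof -
    have "d < d + inverse (Suc n)" by simp
    then show ?thesis unfolding d_def using cINF_less_iff[OF ne bdd] by blast
  qed
  then obtain y where y: "\<And>n. y n \<in> K" "\<And>n. (norm (x - y n))\<^sup>2 < d + inverse (Suc n)"
    by metis
  \<comment> \<open>The midpoint of \<open>y m\<close> and \<open>y n\<close> lies in
    \<open>K\<close>, so its squared distance to \<open>x\<close> is at least \<open>d\<close>; the
    parallelogram law converts this into a bound on the distance of the two points.\<close>
  have close: "(dist (y m) (y n))\<^sup>2 \<le> 2 * inverse (Suc m) + 2 * inverse (Suc n)" for m n
  proof -
    have "(1/2) *\<^sub>R (y m + y n) \<in> K"
      using assms(2) y(1) by (intro subspace_scale subspace_add)
    then have "d \<le> (norm (x - (1/2) *\<^sub>R (y m + y n)))\<^sup>2" by (rule d_le)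
    also have "\<dots> = (norm ((1/2) *\<^sub>R ((x - y m) + (x - y n))))\<^sup>2"
      by (simp add: algebra_simps flip: scaleR_left.add)
    also have "\<dots> = (1/4) * (norm ((x - y m) + (x - y n)))\<^sup>2"
      by (simp add: power_mult_distrib power2_eq_square)
    finally have "4 * d \<le> (norm ((x - y m) + (x - y n)))\<^sup>2" by simp
    moreover have "(norm ((x - y m) + (x - y n)))\<^sup>2 + (norm ((x - y m) - (x - y n)))\<^sup>2
        = 2 * (norm (x - y m))\<^sup>2 + 2 * (norm (x - y n))\<^sup>2"
      by (rule parallelogram)
    moreover have "norm ((x - y m) - (x - y n)) = dist (y m) (y n)"
      by (simp add: dist_norm norm_minus_commute)
    ultimately show ?thesis using y(2)[of m] y(2)[of n] by simp
  qed
  have "Cauchy y"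
  proof (rule metric_CauchyI)
    fix e :: real assume e: "0 < e"
    obtain M where M: "inverse (Suc M) < e\<^sup>2 / 4"
      using reals_Archimedean[of "e\<^sup>2 / 4"] e by auto
    have "dist (y m) (y n) < e" if "M \<le> m" "M \<le> n" for m n
    proof -
      have "inverse (real (Suc m)) \<le> inverse (Suc M)" "inverse (real (Suc n)) \<le> inverse (Suc M)"
        using that by (auto intro!: le_imp_inverse_le)
      then have "(dist (y m) (y n))\<^sup>2 < e\<^sup>2" using close[of m n] M by linarith
      then show ?thesis using e by (simp add: power2_less_imp_less)
    qed
    then show "\<exists>M. \<forall>m\<ge>M. \<forall>n\<ge>M. dist (y m) (y n) < e" by blast
  qed
  then obtain k where k: "y \<longlonglongrightarrow> k" using Cauchy_convergent convergent_def by blast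
  have "k \<in> K" using assms(1) y(1) k closed_sequentially by blast
  have "(\<lambda>n. (norm (x - y n))\<^sup>2) \<longlonglongrightarrow> (norm (x - k))\<^sup>2"
    by (intro tendsto_intros k)
  moreover have "(\<lambda>n. d + inverse (Suc n)) \<longlonglongrightarrow> d + 0"
    by (intro tendsto_intros LIMSEQ_inverse_real_of_nat)
  ultimately have "(norm (x - k))\<^sup>2 \<le> d + 0"
    by (rule LIMSEQ_le) (use y(2) in \<open>auto intro: less_imp_le\<close>)
  then have "norm (x - k) \<le> norm (x - z)" if "z \<in> K" for z
    using d_le[OF that] by (auto intro: power2_le_imp_le[OF order_trans])
  then show ?thesis using \<open>k \<in> K\<close> by blast
qed

lemma orthogonal_decomposition:
  fixes K :: "'a::{real_inner, complete_space} set"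
  assumes "closed K" "subspace K"
  shows "\<exists>k\<in>K. \<forall>y\<in>K. inner (x - k) y = 0"
proof -
  obtain k where k: "k \<in> K" "\<And>y. y \<in> K \<Longrightarrow> norm (x - k) \<le> norm (x - y)"
    using exists_nearest_point[OF assms] by blast
  have "inner (x - k) y = 0" if "y \<in> K" for y
  proof (cases "y = 0")
    case False
    \<comment> \<open>The \<open>t\<close> that minimizes the norm of
      \<open>(x - k) - t *\<^sub>R y\<close>; a nonzero inner product would make
      \<open>k + t *\<^sub>R y\<close> strictly closer to \<open>x\<close> than
      \<open>k\<close>.\<close>
    define t where "t = inner (x - k) y / (norm y)\<^sup>2"
    have "k + t *\<^sub>R y \<in> K" using assms(2) k(1) that by (intro subspace_add subspace_scale)
    then have "(norm (x - k))\<^sup>2 \<le> (norm ((x - k) - t *\<^sub>R y))\<^sup>2"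
      using k(2) by (metis diff_diff_eq norm_ge_zero power_mono)
    also have "\<dots> = (norm (x - k))\<^sup>2 - 2 * t * inner (x - k) y + t\<^sup>2 * (norm y)\<^sup>2"
      unfolding power2_norm_eq_inner inner_diff_left inner_diff_right
      by (simp add: inner_commute power2_eq_square algebra_simps)
    also have "\<dots> = (norm (x - k))\<^sup>2 - (inner (x - k) y)\<^sup>2 / (norm y)\<^sup>2"
      using False by (simp add: t_def field_simps power2_eq_square)
    finally have "(inner (x - k) y)\<^sup>2 / (norm y)\<^sup>2 \<le> 0" by simp
    then show ?thesis using False by (simp add: divide_le_0_iff)
  qed simp
  then show ?thesis using k(1) by blast
qed

lemma riesz_representation:
  fixes g :: "'a::{real_inner, complete_space} \<Rightarrow> real"
  assumes "bounded_linear g"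
  shows "\<exists>u. \<forall>x. g x = inner x u"
proof (cases "\<forall>x. g x = 0")
  case False
  then obtain a where a: "g a \<noteq> 0" by blast
  interpret g: bounded_linear g by fact
  have "closed (g -` {0})"
    by (intro continuous_closed_vimage closed_singleton) (simp add: g.isCont)
  moreover have "subspace (g -` {0})" by (simp add: subspace_def g.add g.zero g.scaleR)
  ultimately obtain k where k: "g k = 0" "\<And>y. g y = 0 \<Longrightarrow> inner (a - k) y = 0"
    using orthogonal_decomposition[of "g -` {0}" a] by auto
  define m where "m = a - k"
  have gm: "g m \<noteq> 0" using a k by (simp add: m_def g.diff)
  then have "m \<noteq> 0" using g.zero by auto
  have "g x = inner x ((g m / (norm m)\<^sup>2) *\<^sub>R m)" for x
  proof -
    \<comment> \<open>Removing the right multiple of \<open>m\<close> moves \<open>x\<close> into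
      the kernel of \<open>g\<close>, to which \<open>m\<close> is orthogonal.\<close>
    have "g (x - (g x / g m) *\<^sub>R m) = 0" using gm by (simp add: g.diff g.scaleR)
    then have "inner m (x - (g x / g m) *\<^sub>R m) = 0" using k(2) by (simp add: m_def)
    then have "inner x m = (g x / g m) * (norm m)\<^sup>2"
      by (simp add: inner_diff_right inner_commute power2_norm_eq_inner)
    then show ?thesis using gm \<open>m \<noteq> 0\<close> by simp
  qed
  then show ?thesis by blast
qed (auto intro: exI[of _ 0])

section \<open>Complex subspaces and their orthogonal projections\<close>

definition csubspace :: "'a::complex_hilbert_space set \<Rightarrow> bool" where
  "csubspace K \<longleftrightarrow> subspace K \<and> (\<forall>c. \<forall>x\<in>K. c *\<^sub>C x \<in> K)"

lemma csubspace_range: "bounded_clinear T \<Longrightarrow> csubspace (range T)"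
  unfolding csubspace_def
proof (intro conjI allI ballI)
  assume T: "bounded_clinear T"
  show "subspace (range T)"
    using T by (intro linear_subspace_image subspace_UNIV bounded_clinear_linear)
  fix c x assume "x \<in> range T"
  then obtain y where "x = T y" by blast
  then have "c *\<^sub>C x = T (c *\<^sub>C y)" using T by (simp add: bounded_clinear_scaleC)
  then show "c *\<^sub>C x \<in> range T" by blast
qed

lemma subspace_closure:
  fixes K :: "'a::real_normed_vector set"
  assumes "subspace K"
  shows "subspace (closure K)"
  unfolding subspace_def
proof safe
  show "0 \<in> closure K" using subspace_0[OF assms] closure_subset by blast
  fix x y assume "x \<in> closure K" "y \<in> closure K"
  then obtain a b where "\<And>n. a n \<in> K" "a \<longlonglongrightarrow> x" "\<And>n. b n \<in> K" "b \<longlonglongrightarrow> y"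
    by (auto simp: closure_sequential)
  then show "x + y \<in> closure K"
    unfolding closure_sequential using assms
    by (intro exI[of _ "\<lambda>n. a n + b n"]) (auto intro: tendsto_add subspace_add)
next
  fix c x assume "x \<in> closure K"
  then obtain a where "\<And>n. a n \<in> K" "a \<longlonglongrightarrow> x" by (auto simp: closure_sequential)
  then show "c *\<^sub>R x \<in> closure K"
    unfolding closure_sequential using assms
    by (intro exI[of _ "\<lambda>n. c *\<^sub>R a n"]) (auto intro: tendsto_intros subspace_scale)
qed

lemma csubspace_closure: "csubspace K \<Longrightarrow> csubspace (closure K)"
  unfolding csubspace_def
proof safe
  fix c x assume K: "\<forall>c. \<forall>x\<in>K. c *\<^sub>C x \<in> K" "x \<in> closure K"
  then obtain y where "\<And>n. y n \<in> K" "y \<longlonglongrightarrow> x" by (auto simp: closure_sequential)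
  then show "c *\<^sub>C x \<in> closure K"
    unfolding closure_sequential using K
    by (intro exI[of _ "\<lambda>n. c *\<^sub>C y n"]) (auto intro: tendsto_scaleC)
qed (rule subspace_closure)

text \<open>Real orthogonality to \<open>y\<close> and to \<open>\<i> *\<^sub>C y\<close> is complex
  orthogonality to \<open>y\<close>, and a complex subspace contains both.\<close>

lemma corthogonal_decomposition:
  assumes "closed K" "csubspace K"
  shows "\<exists>k\<in>K. \<forall>y\<in>K. cinner (x - k) y = 0"
proof -
  obtain k where "k \<in> K" "\<forall>y\<in>K. inner (x - k) y = 0"
    using orthogonal_decomposition assms unfolding csubspace_def by blast
  moreover have "\<i> *\<^sub>C y \<in> K" if "y \<in> K" for y using assms(2) that by (auto simp: csubspace_def)
  ultimately show ?thesis by (auto simp: cinner_eq_inner Complex_eq_0 intro!: bexI[of _ k])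
qed

text \<open>\<open>E\<close> is chosen pointwise from the decomposition; the component in
  \<open>K\<close> is unique, and this uniqueness yields linearity and the values on
  \<open>K\<close> and on its orthogonal complement.\<close>

lemma corthogonal_projection:
  assumes "closed K" "csubspace K"
  obtains E where "bounded_clinear E" "range E \<subseteq> K" "\<And>x y. y \<in> K \<Longrightarrow> cinner (x - E x) y = 0"
    "\<And>x. x \<in> K \<Longrightarrow> E x = x" "\<And>x. (\<And>y. y \<in> K \<Longrightarrow> cinner y x = 0) \<Longrightarrow> E x = 0"
    "\<And>x. norm (E x) \<le> norm x"
proof -
  have sub: "subspace K" and scC: "\<And>c x. x \<in> K \<Longrightarrow> c *\<^sub>C x \<in> K"
    using assms(2) by (auto simp: csubspace_def)
  obtain E where E: "\<And>x. E x \<in> K" "\<And>x y. y \<in> K \<Longrightarrow> cinner (x - E x) y = 0"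
    using corthogonal_decomposition[OF assms] by metis
  have uniq: "E x = k" if "k \<in> K" "\<And>y. y \<in> K \<Longrightarrow> cinner (x - k) y = 0" for x k
  proof -
    have "E x - k \<in> K" using sub that(1) E(1) by (simp add: subspace_diff)
    then have "cinner ((x - k) - (x - E x)) (E x - k) = 0"
      using that(2) E(2) \<open>E x - k \<in> K\<close> by (subst cinner_diff_left) simp
    then have "cinner (E x - k) (E x - k) = 0" by simp
    then show ?thesis by (simp add: cinner_self)
  qed
  have le: "norm (E x) \<le> norm x" for x
  proof -
    have "cinner (E x) (E x) = cinner x (E x)"
      using E(2)[OF E(1), of x x] by (simp add: cinner_diff_left)
    then have "(norm (E x))\<^sup>2 = inner x (E x)"
      by (metis cinner_self Re_complex_of_real inner_eq_Re_cinner)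
    also have "\<dots> \<le> norm x * norm (E x)" by (rule norm_cauchy_schwarz)
    finally show ?thesis by (cases "E x = 0") (auto simp: power2_eq_square)
  qed
  have "bounded_clinear E"
  proof (rule bounded_clinearI[of _ 1])
    show "E (x + y) = E x + E y" for x y
    proof (rule uniq)
      show "E x + E y \<in> K" using sub E(1) by (simp add: subspace_add)
      show "cinner (x + y - (E x + E y)) z = 0" if "z \<in> K" for z
        using E(2)[OF that, of x] E(2)[OF that, of y]
        by (simp add: cinner_add_left cinner_diff_left)
    qed
    show "E (c *\<^sub>C x) = c *\<^sub>C E x" for c x
    proof (rule uniq)
      show "c *\<^sub>C E x \<in> K" using scC E(1) by simp
      show "cinner (c *\<^sub>C x - c *\<^sub>C E x) z = 0" if "z \<in> K" for z
        using E(2)[OF that, of x] by (simp add: cinner_scaleC_left flip: scaleC_diff_right)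
    qed
  qed (use le in simp)
  moreover have "E x = x" if "x \<in> K" for x using that by (intro uniq) auto
  moreover have "E x = 0" if "\<And>y. y \<in> K \<Longrightarrow> cinner y x = 0" for x
  proof (rule uniq)
    show "0 \<in> K" using sub by (rule subspace_0)
    show "cinner (x - 0) y = 0" if "y \<in> K" for y
      using \<open>y \<in> K \<Longrightarrow> cinner y x = 0\<close> that cinner_commute[of x y] by simp
  qed
  ultimately show ?thesis using that E le by blast
qed

text \<open>Riesz representation of \<open>x \<mapsto> inner (T x) y\<close> supplies the operator
  that the \<open>THE\<close> in \<open>cadjoint\<close> asks for; testing against all vectors makes
  it unique.\<close>

lemma cinner_cadjoint:
  fixes T :: "'a::complex_hilbert_space \<Rightarrow> 'b::complex_hilbert_space"
  assumes "bounded_clinear T"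
  shows "cinner (T x) y = cinner x (cadjoint T y)"
proof -
  have "\<exists>u. \<forall>x. inner (T x) y = inner x u" for y
    using assms by (intro riesz_representation bounded_linear_compose[OF bounded_linear_inner_left])
      (simp add: bounded_clinear_bounded_linear)
  then obtain S where S: "\<And>x y. inner (T x) y = inner x (S y)" by metis
  have "cinner (T x) y = cinner x (S y)" for x y
  proof (rule complex_eqI)
    \<comment> \<open>Multiplying \<open>x\<close> by \<open>- \<i>\<close> turns the identity of
      real parts into one of imaginary parts.\<close>
    have "inner (T (- \<i> *\<^sub>C x)) y = inner (- \<i> *\<^sub>C x) (S y)" by (rule S)
    then show "Im (cinner (T x) y) = Im (cinner x (S y))"
      using assms by (simp add: bounded_clinear_scaleC inner_eq_Re_cinner cinner_scaleC_left)
  qed (use S in \<open>simp add: inner_eq_Re_cinner\<close>)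
  then have "cadjoint T = S"
    unfolding cadjoint_def by (intro the_equality ext cinner_ext_right) simp_all
  then show ?thesis by (simp add: \<open>\<And>x y. cinner (T x) y = cinner x (S y)\<close>)
qed

lemma cadjoint_eqI:
  assumes "bounded_clinear T" "\<And>x. cinner (T x) y = cinner x z"
  shows "cadjoint T y = z"
  using assms by (intro cinner_ext_right) (simp flip: cinner_cadjoint)

text \<open>Polarization: a real quadratic form at \<open>x + y\<close> makes the imaginary part of
  \<open>cinner (A x) y\<close> antisymmetric, and replacing \<open>x\<close> by
  \<open>\<i> *\<^sub>C x\<close> then makes its real part symmetric.\<close>

lemma positive_op_cinner:
  assumes "positive_op A"
  shows "cinner (A x) y = cinner x (A y)"
proof -
  have bc: "bounded_clinear A" and real: "\<And>x. Im (cinner (A x) x) = 0"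
    using assms by (auto simp: positive_op_def complex_is_Real_iff)
  define f where "f x y = cinner (A x) y" for x y
  have im: "Im (f x y) = - Im (f y x)" for x y
    using real[of "x + y"] real[of x] real[of y]
    by (simp add: f_def bounded_clinearD[OF bc] cinner_add_left cinner_add_right)
  have "Im (f (\<i> *\<^sub>C x) y) = - Im (f y (\<i> *\<^sub>C x))" by (rule im)
  then have re: "Re (f x y) = Re (f y x)"
    by (simp add: f_def bounded_clinearD[OF bc] cinner_scaleC_left cinner_scaleC_right)
  have "f x y = cnj (f y x)" using im[of x y] re by (simp add: complex_eq_iff)
  then show ?thesis unfolding f_def by (simp add: cinner_commute[of x])
qed

section \<open>Continuous functional calculus\<close>

definition cpoly_op :: "complex poly \<Rightarrow> ('a::complex_hilbert_space \<Rightarrow> 'a) \<Rightarrow> 'a \<Rightarrow> 'a" where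
  "cpoly_op p P x = (\<Sum>i\<le>degree p. coeff p i *\<^sub>C (P ^^ i) x)"

text \<open>Passing to complex coefficients makes the fundamental theorem of algebra available,
  which splits a polynomial into linear factors.\<close>

lemma poly_op_eq_cpoly_op: "poly_op p P x = cpoly_op (map_poly of_real p) P x"
  by (simp add: poly_op_def cpoly_op_def scaleR_scaleC coeff_map_poly degree_map_poly)

lemma cpoly_op_degree_le:
  "degree p \<le> n \<Longrightarrow> cpoly_op p P x = (\<Sum>i\<le>n. coeff p i *\<^sub>C (P ^^ i) x)"
  unfolding cpoly_op_def by (rule sum.mono_neutral_left) (auto simp: coeff_eq_0)

lemma cpoly_op_0 [simp]: "cpoly_op 0 P x = 0"
  by (simp add: cpoly_op_def)

lemma cpoly_op_add: "cpoly_op (p + q) P x = cpoly_op p P x + cpoly_op q P x"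
proof -
  define n where "n = max (degree p) (degree q)"
  have "degree (p + q) \<le> n" "degree p \<le> n" "degree q \<le> n"
    unfolding n_def by (auto intro: degree_add_le_max)
  then show ?thesis
    by (simp add: cpoly_op_degree_le[of _ n] scaleC_add_left sum.distrib)
qed

lemma cpoly_op_smult: "cpoly_op (smult c p) P x = c *\<^sub>C cpoly_op p P x"
  unfolding cpoly_op_degree_le[OF degree_smult_le] cpoly_op_def
  by (simp add: scaleC_sum_right scaleC_scaleC)

lemma cpoly_op_pCons:
  assumes "bounded_clinear P"
  shows "cpoly_op (pCons a p) P x = a *\<^sub>C x + P (cpoly_op p P x)"
proof -
  have "cpoly_op (pCons a p) P x
      = (\<Sum>i\<le>Suc (degree p). coeff (pCons a p) i *\<^sub>C (P ^^ i) x)"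
    by (rule cpoly_op_degree_le) (simp add: degree_pCons_le)
  then show ?thesis
    by (simp add: sum.atMost_Suc_shift cpoly_op_def bounded_clinear_sum[OF assms]
        bounded_clinear_scaleC[OF assms] del: sum.atMost_Suc)
qed

lemma cpoly_op_mult:
  assumes "bounded_clinear P"
  shows "cpoly_op (p * q) P x = cpoly_op p P (cpoly_op q P x)"
  by (induction p)
    (simp_all add: cpoly_op_add cpoly_op_smult cpoly_op_pCons[OF assms])

lemma map_poly_of_real_add:
  "map_poly complex_of_real (p + q) = map_poly of_real p + map_poly of_real q"
  by (rule poly_eqI) (simp add: coeff_map_poly)

lemma map_poly_of_real_mult:
  "map_poly complex_of_real (p * q) = map_poly of_real p * map_poly of_real q"
  by (rule poly_eqI) (simp add: coeff_map_poly coeff_mult)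

lemma poly_map_poly_of_real: "poly (map_poly complex_of_real p) (of_real t) = of_real (poly p t)"
  by (simp add: poly_altdef coeff_map_poly degree_map_poly)

lemma poly_op_mult: "bounded_clinear P \<Longrightarrow> poly_op (p * q) P x = poly_op p P (poly_op q P x)"
  by (simp add: poly_op_eq_cpoly_op map_poly_of_real_mult cpoly_op_mult)

lemma poly_op_add: "poly_op (p + q) P x = poly_op p P x + poly_op q P x"
  by (simp add: poly_op_eq_cpoly_op map_poly_of_real_add cpoly_op_add)

lemma poly_op_diff: "poly_op (p - q) P x = poly_op p P x - poly_op q P x"
proof -
  have "poly_op (p - q) P x + poly_op q P x = poly_op p P x"
    by (simp flip: poly_op_add)
  then show ?thesis by (simp add: algebra_simps)
qed

lemma bounded_clinear_cpoly_op:
  assumes "bounded_clinear P"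
  shows "bounded_clinear (cpoly_op p P)"
proof (induction p)
  case 0
  show ?case by (rule bounded_clinearI[of _ 0]) simp_all
next
  case (pCons a p)
  have "bounded_clinear (\<lambda>x. a *\<^sub>C x + (P \<circ> cpoly_op p P) x)"
    using assms pCons
    by (intro bounded_clinear_plus bounded_clinear_compose bounded_clinear_const_scaleC)
  then show ?case by (simp add: cpoly_op_pCons[OF assms, abs_def])
qed

lemma bounded_clinear_poly_op: "bounded_clinear P \<Longrightarrow> bounded_clinear (poly_op p P)"
  unfolding poly_op_eq_cpoly_op[abs_def] by (rule bounded_clinear_cpoly_op)

section \<open>Self-adjointness and spectral bounds for polynomials of a positive operator\<close>

lemma poly_op_cinner:
  assumes "\<And>x y. cinner (P x) y = cinner x (P y)"
  shows "cinner (poly_op p P x) y = cinner x (poly_op p P y)"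
proof -
  have "cinner ((P ^^ i) x) y = cinner x ((P ^^ i) y)" for i x y
    by (induction i arbitrary: y) (simp_all add: assms flip: funpow_swap1)
  then show ?thesis
    by (simp add: poly_op_def cinner_sum_left cinner_sum_right cinner_scaleR_left
        cinner_scaleR_right)
qed

text \<open>On unit vectors the quadratic form of \<open>P\<close> takes values between
  \<open>0\<close> and \<open>onorm P\<close>. For \<open>z\<close> off that interval one of
  \<open>\<bar>Im z\<bar>\<close>, \<open>- Re z\<close> and \<open>Re z - onorm P\<close> is
  positive and bounds the form of \<open>P - z\<close> away from zero.\<close>

lemma positive_op_minus_bounded_below:
  assumes P: "positive_op P" and z: "z \<notin> of_real ` {0..onorm P}"
  shows "\<exists>k>0. \<forall>x. k * norm x \<le> norm (P x - z *\<^sub>C x)"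
proof -
  have bc: "bounded_clinear P" and pos: "\<And>x. Im (cinner (P x) x) = 0" "\<And>x. 0 \<le> Re (cinner (P x) x)"
    using P by (auto simp: positive_op_def complex_is_Real_iff)
  have *: "\<exists>k>0. \<forall>x. k * norm x \<le> norm (P x - z *\<^sub>C x)"
    if "0 < k" "\<And>x. k * (norm x)\<^sup>2 \<le> cmod (cinner (P x - z *\<^sub>C x) x)" for k
  proof (intro exI[of _ k] conjI allI)
    fix x
    have "k * (norm x)\<^sup>2 \<le> norm (P x - z *\<^sub>C x) * norm x"
      using that(2) norm_cinner_le by (rule order_trans)
    then show "k * norm x \<le> norm (P x - z *\<^sub>C x)"
      by (cases "x = 0") (simp_all add: power2_eq_square)
  qed fact
  have eq: "cinner (P x - z *\<^sub>C x) x = cinner (P x) x - z * of_real ((norm x)\<^sup>2)" for x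
    by (simp add: cinner_diff_left cinner_scaleC_left cinner_self)
  show ?thesis
  proof (cases "Im z = 0")
    case False
    have "\<bar>Im z\<bar> * (norm x)\<^sup>2 \<le> cmod (cinner (P x - z *\<^sub>C x) x)" for x
      using abs_Im_le_cmod[of "cinner (P x - z *\<^sub>C x) x"]
      by (simp add: eq pos abs_mult del: of_real_power)
    then show ?thesis using False by (intro *[of "\<bar>Im z\<bar>"]) auto
  next
    case True
    then have "z = of_real (Re z)" by (simp add: complex_eq_iff)
    then consider "Re z < 0" | "onorm P < Re z" using z by (metis atLeastAtMost_iff imageI not_le)
    then show ?thesis
    proof cases
      case 1
      have "- Re z * (norm x)\<^sup>2 \<le> cmod (cinner (P x - z *\<^sub>C x) x)" for x
        using complex_Re_le_cmod[of "cinner (P x - z *\<^sub>C x) x"] pos(2)[of x]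
        by (simp add: eq del: of_real_power)
      then show ?thesis using 1 by (intro *[of "- Re z"]) auto
    next
      case 2
      have "(Re z - onorm P) * (norm x)\<^sup>2 \<le> cmod (cinner (P x - z *\<^sub>C x) x)" for x
      proof -
        have "Re (cinner (P x) x) \<le> norm (P x) * norm x"
          using norm_cinner_le complex_Re_le_cmod order_trans by blast
        also have "\<dots> \<le> onorm P * norm x * norm x"
          using norm_bounded_clinear_le[OF bc] by (intro mult_right_mono) auto
        finally show ?thesis
          using abs_Re_le_cmod[of "cinner (P x - z *\<^sub>C x) x"]
          by (simp add: eq left_diff_distrib power2_eq_square mult.assoc del: of_real_power of_real_mult)
      qed
      then show ?thesis using 2 by (intro *[of "Re z - onorm P"]) auto
    qed
  qed
qed

text \<open>Induction on the degree: a root \<open>z\<close> supplied by the fundamental theorem of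
  algebra lies off the interval, so the factor \<open>P - z\<close> is bounded below, and so is its
  composition with the quotient polynomial. Boundedness below does the work of
  invertibility.\<close>

lemma cpoly_op_bounded_below:
  assumes P: "positive_op P"
  shows "(\<And>t. t \<in> {0..onorm P} \<Longrightarrow> poly q (of_real t) \<noteq> 0) \<Longrightarrow>
    \<exists>k>0. \<forall>x. k * norm x \<le> norm (cpoly_op q P x)"
proof (induction "degree q" arbitrary: q)
  have bc: "bounded_clinear P" using P by (simp add: positive_op_def)
  case 0
  then obtain a where q: "q = [:a:]" by (metis degree_eq_zeroE)
  have "0 \<in> {0..onorm P}" using bc by (simp add: onorm_nonneg)
  then have "a \<noteq> 0" using 0(2)[of 0] q by simp
  then show ?case
    by (intro exI[of _ "cmod a"]) (simp add: q cpoly_op_pCons[OF bc] bounded_clinear_zero[OF bc])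
next
  have bc: "bounded_clinear P" using P by (simp add: positive_op_def)
  case (Suc n)
  have "\<not> constant (poly q)" using Suc(2) by (simp add: constant_degree)
  then obtain z where "poly q z = 0" using fundamental_theorem_of_algebra by blast
  then obtain q' where q: "q = [:-z, 1:] * q'" by (metis poly_eq_0_iff_dvd dvdE)
  have "q' \<noteq> 0" using Suc(2) q by auto
  then have "degree q = Suc (degree q')" unfolding q by (subst degree_mult_eq) auto
  then have "n = degree q'" using Suc(2) by simp
  moreover have "poly q' (of_real t) \<noteq> 0" if "t \<in> {0..onorm P}" for t
    using Suc(3)[OF that] by (auto simp: q)
  ultimately obtain k where k: "k > 0" "\<And>x. k * norm x \<le> norm (cpoly_op q' P x)"
    using Suc(1)[of q'] by blast
  have "z \<notin> of_real ` {0..onorm P}" using Suc(3) \<open>poly q z = 0\<close> by (metis imageE)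
  then obtain l where l: "l > 0" "\<And>x. l * norm x \<le> norm (P x - z *\<^sub>C x)"
    using positive_op_minus_bounded_below[OF P] by blast
  have neg: "- z *\<^sub>C x = - (z *\<^sub>C x)" for x :: 'a
    using scaleC_add_left[of z "-z" x] by (simp add: eq_neg_iff_add_eq_0 add.commute)
  have eq: "cpoly_op q P x = P (cpoly_op q' P x) - z *\<^sub>C cpoly_op q' P x" for x
    by (simp add: q cpoly_op_mult[OF bc] cpoly_op_pCons[OF bc] bounded_clinear_zero[OF bc] neg
        del: mult_pCons_left)
  have "l * (k * norm x) \<le> norm (cpoly_op q P x)" for x
    using l(2)[of "cpoly_op q' P x"] k(2)[of x] l(1) eq[of x]
    by (metis mult_left_mono less_imp_le order_trans)
  then show ?case using k(1) l(1) by (intro exI[of _ "l * k"]) (simp add: mult.assoc)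
qed

text \<open>
  If \<open>M = \<parallel>p(P)\<parallel>\<close> exceeded the supremum of \<open>|p|\<close>, then \<open>p\<^sup>2 - M\<^sup>2\<close> would have no zero on
  \<open>[0, \<parallel>P\<parallel>]\<close>, so \<open>p(P)\<^sup>2 - M\<^sup>2\<close> would be bounded below; but a self-adjoint operator \<open>R\<close> of
  norm \<open>M\<close> has \<open>M\<^sup>2\<close> as an approximate eigenvalue of \<open>R\<^sup>2\<close>.
\<close>

lemma onorm_poly_op_le:
  assumes P: "positive_op P" and N: "\<And>t. t \<in> {0..onorm P} \<Longrightarrow> \<bar>poly p t\<bar> \<le> N"
  shows "onorm (poly_op p P) \<le> N"
proof (rule ccontr)
  assume contr: "\<not> onorm (poly_op p P) \<le> N"
  define R where "R = poly_op p P"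
  define M where "M = onorm R"
  have bc: "bounded_clinear P" using P by (simp add: positive_op_def)
  have bR: "bounded_clinear R" unfolding R_def by (rule bounded_clinear_poly_op[OF bc])
  have "0 \<in> {0..onorm P}" using bc by (simp add: onorm_nonneg)
  then have "0 \<le> N" using N[of 0] by linarith
  then have M: "M > N" "M > 0" using contr by (auto simp: M_def R_def)
  define q where "q = map_poly complex_of_real p * map_poly of_real p + [:- of_real (M\<^sup>2):]"
  have q_op: "cpoly_op q P x = R (R x) - M\<^sup>2 *\<^sub>R x" for x
  proof -
    have "- of_real (M\<^sup>2) *\<^sub>C x = - (M\<^sup>2 *\<^sub>R x)"
      using scaleR_scaleC[of "- (M\<^sup>2)" x] by simp
    then show ?thesis
      by (simp add: q_def R_def cpoly_op_add cpoly_op_mult[OF bc] cpoly_op_pCons[OF bc]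
        bounded_clinear_zero[OF bc] poly_op_eq_cpoly_op[abs_def] del: of_real_power)
  qed
  have "poly q (of_real t) \<noteq> 0" if "t \<in> {0..onorm P}" for t
  proof -
    have "\<bar>poly p t\<bar> < M" using N[OF that] M by linarith
    then have "(poly p t)\<^sup>2 \<noteq> M\<^sup>2" using M(2) by (simp add: power2_eq_iff abs_if split: if_splits)
    then show ?thesis
      by (simp add: q_def poly_map_poly_of_real power2_eq_square flip: of_real_mult)
  qed
  then obtain k where k: "k > 0" "\<And>x. k * norm x \<le> norm (R (R x) - M\<^sup>2 *\<^sub>R x)"
    using cpoly_op_bounded_below[OF P, of q] unfolding q_op by metis
  have sa: "inner (R x) y = inner x (R y)" for x y
    using poly_op_cinner[OF positive_op_cinner[OF P]] by (simp add: R_def inner_eq_Re_cinner)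
  have le: "norm (R x) \<le> M * norm x" for x
    using norm_bounded_clinear_le[OF bR] by (simp add: M_def)
  \<comment> \<open>Expanding the squared lower bound and using self-adjointness of \<open>R\<close>
    bounds \<open>norm (R x)\<close> by \<open>norm x\<close> times a factor strictly below
    \<open>M\<close>, against the choice of \<open>M\<close>.\<close>
  have "(norm (R x))\<^sup>2 \<le> (M\<^sup>2 - k\<^sup>2 / M\<^sup>2) * (norm x)\<^sup>2" for x
  proof -
    have "(k * norm x)\<^sup>2 \<le> (norm (R (R x) - M\<^sup>2 *\<^sub>R x))\<^sup>2"
      using k by (intro power_mono) auto
    also have "\<dots> = (norm (R (R x)))\<^sup>2 - 2 * M\<^sup>2 * inner (R (R x)) x + M^4 * (norm x)\<^sup>2"
      unfolding power2_norm_eq_inner inner_diff_left inner_diff_right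
      by (simp add: inner_commute power2_eq_square power4_eq_xxxx algebra_simps)
    also have "inner (R (R x)) x = (norm (R x))\<^sup>2"
      by (simp add: sa power2_norm_eq_inner)
    also have "(norm (R (R x)))\<^sup>2 \<le> (M * norm (R x))\<^sup>2"
      using le by (intro power_mono) auto
    finally have "M\<^sup>2 * (norm (R x))\<^sup>2 \<le> M^4 * (norm x)\<^sup>2 - k\<^sup>2 * (norm x)\<^sup>2"
      unfolding power_mult_distrib by linarith
    also have "\<dots> = M\<^sup>2 * ((M\<^sup>2 - k\<^sup>2 / M\<^sup>2) * (norm x)\<^sup>2)"
      using M(2) by (simp add: field_simps power2_eq_square power4_eq_xxxx)
    finally have "M\<^sup>2 * (norm (R x))\<^sup>2 \<le> M\<^sup>2 * ((M\<^sup>2 - k\<^sup>2 / M\<^sup>2) * (norm x)\<^sup>2)" .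
    then show ?thesis using M(2) by simp
  qed
  \<comment> \<open>The \<open>max\<close> makes the root real before
    \<open>M\<^sup>2 - k\<^sup>2 / M\<^sup>2\<close> is known to be nonnegative.\<close>
  moreover define c where "c = sqrt (max 0 (M\<^sup>2 - k\<^sup>2 / M\<^sup>2))"
  ultimately have "(norm (R x))\<^sup>2 \<le> (c * norm x)\<^sup>2" for x
    by (smt (verit) c_def max.cobounded1 max.cobounded2 mult_right_mono power_mult_distrib
        real_sqrt_pow2 zero_le_power2)
  then have "norm (R x) \<le> c * norm x" for x
    by (rule power2_le_imp_le) (simp add: c_def)
  then have "M \<le> c" unfolding M_def by (intro onorm_bound) (simp_all add: c_def)
  then have "M\<^sup>2 \<le> c\<^sup>2" using M(2) by (intro power_mono) auto
  also have "c\<^sup>2 < M\<^sup>2" using M(2) k(1) by (simp add: c_def)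
  finally show False by simp
qed

section \<open>From polynomials to continuous functions\<close>

lemma Weierstrass_poly:
  fixes f :: "real \<Rightarrow> real"
  assumes "compact S" "continuous_on S f"
  obtains p where "uniform_limit S (\<lambda>n. poly (p n)) f sequentially"
proof -
  have "\<exists>p. \<forall>x\<in>S. \<bar>f x - poly p x\<bar> < inverse (Suc n)" for n
  proof -
    obtain g where g: "real_polynomial_function g" "\<And>x. x \<in> S \<Longrightarrow> \<bar>f x - g x\<bar> < inverse (Suc n)"
      using Stone_Weierstrass_real_polynomial_function[OF assms, of "inverse (Suc n)"] by auto
    obtain a m where a: "g = (\<lambda>x. \<Sum>i\<le>m. a i * x ^ i)"
      using g(1) real_polynomial_function_iff_sum by blast
    have "g = poly (\<Sum>i\<le>m. monom (a i) i)"
      by (rule ext) (simp add: a poly_sum poly_monom)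
    then show ?thesis using g(2) by metis
  qed
  then obtain p where p: "\<And>n x. x \<in> S \<Longrightarrow> \<bar>f x - poly (p n) x\<bar> < inverse (Suc n)" by metis
  have "uniform_limit S (\<lambda>n. poly (p n)) f sequentially"
    unfolding uniform_limit_iff
  proof (intro allI impI)
    fix e :: real assume "e > 0"
    then obtain M where M: "inverse (Suc M) < e" using reals_Archimedean by blast
    have "dist (poly (p n) x) (f x) < e" if "n \<ge> M" "x \<in> S" for n x
    proof -
      have "inverse (real (Suc n)) \<le> inverse (Suc M)" using that by (auto intro!: le_imp_inverse_le)
      then have "\<bar>f x - poly (p n) x\<bar> < e" using p[OF that(2), of n] M by linarith
      then show ?thesis by (simp add: dist_real_def abs_minus_commute)
    qed
    then show "\<forall>\<^sub>F n in sequentially. \<forall>x\<in>S. dist (poly (p n) x) (f x) < e"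
      by (auto simp: eventually_sequentially)
  qed
  then show ?thesis using that by blast
qed

text \<open>\<open>onorm_poly_op_le\<close> makes \<open>p \<mapsto> poly_op p P\<close> contractive
  from the sup norm to the operator norm. So one approximating sequence converges in operator norm,
  every other one has the same limit, and the \<open>THE\<close> in
  \<open>functional_calculus\<close> is justified.\<close>

lemma functional_calculus_limit:
  assumes P: "positive_op P" and f: "continuous_on {0..onorm P} f"
  shows bounded_clinear_functional_calculus: "bounded_clinear (functional_calculus f P)"
    and functional_calculus_tendsto:
      "uniform_limit {0..onorm P} (\<lambda>n. poly (p n)) f sequentially \<Longrightarrow>
        (\<lambda>n. poly_op (p n) P x) \<longlonglongrightarrow> functional_calculus f P x"
proof -
  let ?I = "{0..onorm P}"
  let ?u = "\<lambda>p. uniform_limit ?I (\<lambda>n. poly (p n)) f sequentially"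
  let ?C = "\<lambda>Q. bounded_clinear Q \<and>
     (\<forall>p. ?u p \<longrightarrow> (\<lambda>n. onorm (\<lambda>x. poly_op (p n) P x - Q x)) \<longlonglongrightarrow> 0)"
  have bc: "bounded_clinear P" using P by (simp add: positive_op_def)
  note bp = bounded_clinear_poly_op[OF bc]
  have diff: "norm (poly_op p P x - poly_op q P x) \<le> e * norm x"
    if "\<And>t. t \<in> ?I \<Longrightarrow> \<bar>poly p t - poly q t\<bar> \<le> e" for p q e x
  proof -
    have "norm (poly_op p P x - poly_op q P x) = norm (poly_op (p - q) P x)"
      by (simp add: poly_op_diff)
    also have "\<dots> \<le> onorm (poly_op (p - q) P) * norm x" by (rule norm_bounded_clinear_le[OF bp])
    also have "\<dots> \<le> e * norm x" using that by (intro mult_right_mono onorm_poly_op_le[OF P]) auto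
    finally show ?thesis .
  qed
  \<comment> \<open>One approximating sequence is needed for uniqueness as well: otherwise the
    condition on \<open>Q\<close> would hold vacuously.\<close>
  obtain p0 where p0: "?u p0" using Weierstrass_poly[OF compact_Icc f] by blast
  have close: "\<exists>N. \<forall>n\<ge>N. \<forall>t\<in>?I. \<bar>poly (p n) t - f t\<bar> \<le> e" if "?u p" "e > 0" for p e
    using that unfolding uniform_limit_iff eventually_sequentially dist_real_def
    by (meson less_imp_le)
  \<comment> \<open>Taking \<open>p = p0\<close> gives the Cauchy property, and a general
    \<open>p\<close> gives independence of the sequence.\<close>
  have close2: "\<exists>N. \<forall>n\<ge>N. \<forall>m\<ge>N. \<forall>x. norm (poly_op (p n) P x - poly_op (p0 m) P x) \<le> e * norm x"
    if u: "?u p" and e: "e > 0" for p e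
  proof -
    obtain N1 where N1: "\<And>n t. n \<ge> N1 \<Longrightarrow> t \<in> ?I \<Longrightarrow> \<bar>poly (p n) t - f t\<bar> \<le> e / 2"
      using close[OF u half_gt_zero[OF e]] by blast
    obtain N2 where N2: "\<And>n t. n \<ge> N2 \<Longrightarrow> t \<in> ?I \<Longrightarrow> \<bar>poly (p0 n) t - f t\<bar> \<le> e / 2"
      using close[OF p0 half_gt_zero[OF e]] by blast
    show ?thesis
    proof (intro exI[of _ "max N1 N2"] allI impI diff)
      fix n m t assume "max N1 N2 \<le> n" "max N1 N2 \<le> m" "t \<in> ?I"
      then show "\<bar>poly (p n) t - poly (p0 m) t\<bar> \<le> e" using N1[of n t] N2[of m t] by linarith
    qed
  qed
  have "Cauchy (\<lambda>n. poly_op (p0 n) P x)" for x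
  proof (rule metric_CauchyI)
    fix e :: real assume e: "e > 0"
    \<comment> \<open>The summand \<open>1\<close> avoids a division by zero when
      \<open>x = 0\<close>.\<close>
    define e' where "e' = e / (norm x + 1)"
    have e': "e' > 0" "e' * norm x < e"
      using e by (auto simp: e'_def field_simps add_pos_nonneg add_nonneg_pos intro!: divide_pos_pos)
    obtain N where "\<forall>n\<ge>N. \<forall>m\<ge>N. \<forall>x. norm (poly_op (p0 n) P x - poly_op (p0 m) P x) \<le> e' * norm x"
      using close2[OF p0 e'(1)] by blast
    then show "\<exists>M. \<forall>m\<ge>M. \<forall>n\<ge>M. dist (poly_op (p0 m) P x) (poly_op (p0 n) P x) < e"
      using e'(2) by (intro exI[of _ N]) (auto simp: dist_norm intro: order.strict_trans1)
  qed
  then have "\<exists>l. (\<lambda>n. poly_op (p0 n) P x) \<longlonglongrightarrow> l" for x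
    using Cauchy_convergent convergent_def by blast
  then obtain Q where Q: "\<And>x. (\<lambda>n. poly_op (p0 n) P x) \<longlonglongrightarrow> Q x" by metis
  have closeQ: "\<exists>N. \<forall>n\<ge>N. \<forall>x. norm (poly_op (p n) P x - Q x) \<le> e * norm x" if "?u p" "e > 0" for p e
  proof -
    obtain N where N: "\<And>n m x. n \<ge> N \<Longrightarrow> m \<ge> N \<Longrightarrow>
        norm (poly_op (p n) P x - poly_op (p0 m) P x) \<le> e * norm x"
      using close2[OF \<open>?u p\<close> \<open>e > 0\<close>] by blast
    have "norm (poly_op (p n) P x - Q x) \<le> e * norm x" if "n \<ge> N" for n x
      by (rule LIMSEQ_le_const2[OF tendsto_norm[OF tendsto_diff[OF tendsto_const Q]]])
        (use N[OF that] in auto)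
    then show ?thesis by blast
  qed
  have bQ: "bounded_clinear Q"
  proof -
    obtain N where N: "\<And>x. norm (poly_op (p0 N) P x - Q x) \<le> 1 * norm x"
      using closeQ[OF p0, of 1] by auto
    show ?thesis
    proof (rule bounded_clinearI)
      fix x y c
      have "(\<lambda>n. poly_op (p0 n) P x + poly_op (p0 n) P y) \<longlonglongrightarrow> Q x + Q y"
        by (intro tendsto_intros Q)
      then show "Q (x + y) = Q x + Q y"
        using Q[of "x + y"] by (simp add: bounded_clinear_add[OF bp] LIMSEQ_unique)
      have "(\<lambda>n. c *\<^sub>C poly_op (p0 n) P x) \<longlonglongrightarrow> c *\<^sub>C Q x"
        by (intro tendsto_intros Q)
      then show "Q (c *\<^sub>C x) = c *\<^sub>C Q x"
        using Q[of "c *\<^sub>C x"] by (simp add: bounded_clinear_scaleC[OF bp] LIMSEQ_unique)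
      have "norm (Q x) \<le> norm (poly_op (p0 N) P x - Q x) + norm (poly_op (p0 N) P x)"
        using norm_triangle_ineq4[of "poly_op (p0 N) P x" "poly_op (p0 N) P x - Q x"] by simp
      also have "\<dots> \<le> 1 * norm x + onorm (poly_op (p0 N) P) * norm x"
        by (intro add_mono N norm_bounded_clinear_le[OF bp])
      finally show "norm (Q x) \<le> norm x * (1 + onorm (poly_op (p0 N) P))"
        by (simp add: algebra_simps)
    qed
  qed
  have limQ: "(\<lambda>n. onorm (\<lambda>x. poly_op (p n) P x - Q x)) \<longlonglongrightarrow> 0" if u: "?u p" for p
  proof (rule LIMSEQ_I)
    fix e :: real assume "e > 0"
    then obtain N where N: "\<And>n x. n \<ge> N \<Longrightarrow> norm (poly_op (p n) P x - Q x) \<le> e / 2 * norm x"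
      using closeQ[OF u half_gt_zero] by blast
    have "norm (onorm (\<lambda>x. poly_op (p n) P x - Q x) - 0) < e" if "n \<ge> N" for n
    proof -
      have "onorm (\<lambda>x. poly_op (p n) P x - Q x) \<le> e / 2"
        using N[OF that] \<open>e > 0\<close> by (intro onorm_bound) auto
      moreover have "0 \<le> onorm (\<lambda>x. poly_op (p n) P x - Q x)"
        using bp bQ by (intro onorm_pos_le bounded_linear_sub bounded_clinear_bounded_linear)
      ultimately show ?thesis using \<open>e > 0\<close> by simp
    qed
    then show "\<exists>no. \<forall>n\<ge>no. norm (onorm (\<lambda>x. poly_op (p n) P x - Q x) - 0) < e" by blast
  qed
  have pointwise: "(\<lambda>n. poly_op (p n) P x) \<longlonglongrightarrow> Q' x" if "?C Q'" "?u p" for Q' p x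
  proof -
    have "(\<lambda>n. onorm (\<lambda>x. poly_op (p n) P x - Q' x) * norm x) \<longlonglongrightarrow> 0 * norm x"
      using that by (intro tendsto_intros) auto
    then have "(\<lambda>n. poly_op (p n) P x - Q' x) \<longlonglongrightarrow> 0"
    proof (rule Lim_null_comparison[rotated, OF tendsto_eq_rhs])
      show "\<forall>\<^sub>F n in sequentially. norm (poly_op (p n) P x - Q' x)
          \<le> onorm (\<lambda>x. poly_op (p n) P x - Q' x) * norm x"
        using bp that(1)
        by (intro always_eventually allI onorm bounded_linear_sub bounded_clinear_bounded_linear) auto
    qed simp
    then show ?thesis by (rule LIM_zero_cancel)
  qed
  have "?C Q" using bQ limQ by blast
  moreover have "Q' = Q" if "?C Q'" for Q'
    using LIMSEQ_unique[OF pointwise[OF that p0] Q] by (rule ext)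
  ultimately have "functional_calculus f P = Q"
    unfolding functional_calculus_def by (intro the_equality) blast+
  then show "bounded_clinear (functional_calculus f P)"
    and "?u p \<Longrightarrow> (\<lambda>n. poly_op (p n) P x) \<longlonglongrightarrow> functional_calculus f P x"
    using bQ pointwise[OF \<open>?C Q\<close>] by auto
qed

text \<open>\<open>onorm_poly_op_le\<close> controls absolute values only. Subtracting
  \<open>p\<close> from the midpoint of \<open>m\<close> and \<open>M\<close> leaves values of
  modulus at most \<open>h\<close>, and the norm bound then reads as a one-sided estimate of the
  quadratic form.\<close>

lemma poly_op_cinner_ge:
  assumes P: "positive_op P" and p: "\<And>t. t \<in> {0..onorm P} \<Longrightarrow> m \<le> poly p t"
  shows "m * (norm x)\<^sup>2 \<le> Re (cinner (poly_op p P x) x)"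
proof -
  have bc: "bounded_clinear P" using P by (simp add: positive_op_def)
  have "compact (poly p ` {0..onorm P})"
    by (intro compact_continuous_image continuous_intros compact_Icc)
  then obtain M where "\<forall>t\<in>{0..onorm P}. \<bar>poly p t\<bar> \<le> M"
    by (auto dest!: compact_imp_bounded simp: bounded_iff)
  then have M: "\<bar>poly p t\<bar> \<le> M" if "t \<in> {0..onorm P}" for t using that by blast
  define h where "h = (M - m) / 2"
  define q where "q = [:(M + m) / 2:] - p"
  have eq: "poly_op q P x = ((M + m) / 2) *\<^sub>R x - poly_op p P x"
    by (simp add: q_def poly_op_diff) (simp add: poly_op_def)
  have "\<bar>poly q t\<bar> \<le> h" if "t \<in> {0..onorm P}" for t
  proof -
    have "poly q t = (M + m) / 2 - poly p t" by (simp add: q_def)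
    then show ?thesis
      using abs_le_D1[OF M[OF that]] p[OF that] unfolding h_def abs_le_iff by (simp add: field_simps)
  qed
  then have "onorm (poly_op q P) \<le> h" by (rule onorm_poly_op_le[OF P])
  have "Re (cinner (poly_op q P x) x) \<le> norm (poly_op q P x) * norm x"
    using norm_cinner_le complex_Re_le_cmod order_trans by blast
  also have "\<dots> \<le> onorm (poly_op q P) * norm x * norm x"
    by (intro mult_right_mono norm_bounded_clinear_le bounded_clinear_poly_op bc) auto
  also have "\<dots> \<le> h * norm x * norm x"
    using \<open>onorm (poly_op q P) \<le> h\<close> by (intro mult_right_mono) auto
  finally show ?thesis
    by (simp add: eq cinner_diff_left cinner_scaleR_left cinner_self h_def field_simps
        power2_eq_square del: of_real_power)
qed

text \<open>Approximants of \<open>f\<close> eventually exceed \<open>g - e'\<close> on the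
  interval, so the polynomial case applies to their difference from \<open>g\<close> and passes to
  the limit. Polynomial minorants suffice for McCarthy's inequality.\<close>

lemma functional_calculus_cinner_ge:
  assumes P: "positive_op P" and f: "continuous_on {0..onorm P} f"
    and ge: "\<And>t. t \<in> {0..onorm P} \<Longrightarrow> poly g t \<le> f t"
  shows "Re (cinner (poly_op g P x) x) \<le> Re (cinner (functional_calculus f P x) x)"
proof (rule field_le_epsilon)
  fix e :: real assume e: "e > 0"
  obtain p where p: "uniform_limit {0..onorm P} (\<lambda>n. poly (p n)) f sequentially"
    using Weierstrass_poly[OF compact_Icc f] by blast
  define e' where "e' = e / ((norm x)\<^sup>2 + 1)"
  have e': "e' > 0" "e' * (norm x)\<^sup>2 \<le> e"
    using e add_nonneg_pos[of "(norm x)\<^sup>2" 1] by (auto simp: e'_def field_simps)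
  have "\<forall>\<^sub>F n in sequentially. \<forall>t\<in>{0..onorm P}. \<bar>poly (p n) t - f t\<bar> < e'"
    using p e'(1) unfolding uniform_limit_iff dist_real_def by blast
  then have ev: "\<forall>\<^sub>F n in sequentially.
      Re (cinner (poly_op g P x) x) - e \<le> Re (cinner (poly_op (p n) P x) x)"
  proof eventually_elim
    case (elim n)
    have "- e' \<le> poly (p n - g) t" if "t \<in> {0..onorm P}" for t
      using elim[rule_format, OF that] ge[OF that] by (simp add: abs_less_iff)
    then have "- e' * (norm x)\<^sup>2 \<le> Re (cinner (poly_op (p n - g) P x) x)"
      by (rule poly_op_cinner_ge[OF P])
    then show ?case using e'(2) by (simp add: poly_op_diff cinner_diff_left)
  qed
  have "(\<lambda>n. Re (cinner (poly_op (p n) P x) x)) \<longlonglongrightarrow> Re (cinner (functional_calculus f P x) x)"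
    by (intro tendsto_intros functional_calculus_tendsto[OF P f p])
  then have "Re (cinner (poly_op g P x) x) - e \<le> Re (cinner (functional_calculus f P x) x)"
    by (rule tendsto_lowerbound) (use ev in auto)
  then show "Re (cinner (poly_op g P x) x) \<le> Re (cinner (functional_calculus f P x) x) + e"
    by simp
qed

text \<open>\<open>J\<close> is the square root of \<open>P\<close>. If \<open>p n\<close> tends to
  \<open>sqrt\<close>, then \<open>p n * p n\<close> tends to the identity function, and
  self-adjointness of \<open>poly_op (p n) P\<close> lets one factor move across the inner product
  before the limit is taken. Applied to \<open>A\<close>, this gives a witness for the
  \<open>SOME\<close> in \<open>completion_map\<close>.\<close>

lemma positive_op_sqrt:
  fixes P :: "'a::complex_hilbert_space \<Rightarrow> 'a"
  assumes P: "positive_op P"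
  obtains J :: "'a \<Rightarrow> 'a" where "bounded_clinear J" "\<And>x y. cinner (J x) (J y) = cinner (P x) y"
proof -
  let ?I = "{0..onorm P}"
  define J where "J = functional_calculus sqrt P"
  have bc: "bounded_clinear P" using P by (simp add: positive_op_def)
  have f: "continuous_on ?I sqrt" by (intro continuous_intros)
  obtain p where p: "uniform_limit ?I (\<lambda>n. poly (p n)) sqrt sequentially"
    using Weierstrass_poly[OF compact_Icc f] by blast
  have J: "(\<lambda>n. poly_op (p n) P x) \<longlonglongrightarrow> J x" for x
    unfolding J_def by (rule functional_calculus_tendsto[OF P f p])
  have "bounded (sqrt ` ?I)"
    by (intro compact_imp_bounded compact_continuous_image f compact_Icc)
  then have "uniform_limit ?I (\<lambda>n x. poly (p n) x * poly (p n) x) (\<lambda>x. sqrt x * sqrt x) sequentially"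
    by (intro uniform_lim_mult p)
  then have sq: "uniform_limit ?I (\<lambda>n. poly (p n * p n)) (\<lambda>x. x) sequentially"
    by (rule uniform_limit_cong'[THEN iffD1, rotated -1]) auto
  have id: "continuous_on ?I (\<lambda>x. x)" by (intro continuous_intros)
  \<comment> \<open>The constant sequence identifies the calculus of the identity function with
    \<open>P\<close>.\<close>
  have "uniform_limit ?I (\<lambda>n::nat. poly [:0, 1:]) (\<lambda>x. x) sequentially"
    by (simp add: uniform_limit_iff)
  then have "(\<lambda>n::nat. poly_op [:0, 1:] P x) \<longlonglongrightarrow> functional_calculus (\<lambda>x. x) P x" for x
    by (rule functional_calculus_tendsto[OF P id])
  moreover have "poly_op [:0, 1:] P x = P x" for x by (simp add: poly_op_def)
  ultimately have "functional_calculus (\<lambda>x. x) P x = P x" for x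
    by (simp add: LIMSEQ_const_iff)
  then have lim: "(\<lambda>n. poly_op (p n * p n) P x) \<longlonglongrightarrow> P x" for x
    using functional_calculus_tendsto[OF P id sq] by simp
  have "cinner (J x) (J y) = cinner (P x) y" for x y
  proof (rule LIMSEQ_unique)
    show "(\<lambda>n. cinner (poly_op (p n) P x) (poly_op (p n) P y)) \<longlonglongrightarrow> cinner (J x) (J y)"
      by (intro tendsto_intros J)
    have "cinner (poly_op (p n) P x) (poly_op (p n) P y) = cinner (poly_op (p n * p n) P x) y" for n
      by (simp add: poly_op_mult[OF bc] poly_op_cinner[OF positive_op_cinner[OF P]])
    then show "(\<lambda>n. cinner (poly_op (p n) P x) (poly_op (p n) P y)) \<longlonglongrightarrow> cinner (P x) y"
      by (simp only:) (intro tendsto_intros lim)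
  qed
  moreover have "bounded_clinear J"
    unfolding J_def by (rule bounded_clinear_functional_calculus[OF P f])
  ultimately show ?thesis using that[of J] by blast
qed

section \<open>Convexity of powers and McCarthy's inequality\<close>

lemma powr_ge_tangent:
  fixes s p :: real
  assumes "1 \<le> p" "0 \<le> s"
  shows "1 + p * (s - 1) \<le> s powr p"
proof (cases "s = 0")
  case False
  \<comment> \<open>The graph lies above its tangent at \<open>1\<close>; the argument runs on the
    open half-line, so \<open>s = 0\<close> is treated separately.\<close>
  have "((\<lambda>x. x powr p) has_real_derivative p) (at 1 within {0<..})"
    by (auto intro!: derivative_eq_intros)
  then have "p * (s - 1) \<le> s powr p - 1 powr p"
    using False assms powr_convex[of p]
    by (intro convex_on_imp_above_tangent[where A = "{0<..}"]) (auto simp: interior_open)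
  then show ?thesis by simp
qed (use assms in simp)

text \<open>McCarthy's inequality, obtained from the tangent of the convex map \<open>u \<mapsto> u powr r\<close> at
  \<open>u = (norm (P x))\<^sup>2\<close>, evaluated at \<open>u = t\<^sup>2\<close>.\<close>

lemma op_powr_cinner_ge:
  assumes P: "positive_op P" and r: "r \<ge> 1" and x: "norm x = 1"
  shows "norm (P x) powr (2 * r) \<le> Re (cinner (op_powr P (2 * r) x) x)"
proof (cases "P x = 0")
  have f: "continuous_on {0..onorm P} (\<lambda>t. t powr (2 * r))"
    using r by (intro continuous_on_powr' continuous_intros) auto
  \<comment> \<open>The tangent point would be \<open>0\<close> here; the zero polynomial is
    minorant enough, because \<open>0 powr (2 * r) = 0\<close>.\<close>
  case True
  have "Re (cinner (poly_op 0 P x) x) \<le> Re (cinner (op_powr P (2 * r) x) x)"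
    unfolding op_powr_def by (rule functional_calculus_cinner_ge[OF P f]) simp
  then show ?thesis using True by (simp add: poly_op_def)
next
  case False
  have bc: "bounded_clinear P" using P by (simp add: positive_op_def)
  have f: "continuous_on {0..onorm P} (\<lambda>t. t powr (2 * r))"
    using r by (intro continuous_on_powr' continuous_intros) auto
  define l where "l = (norm (P x))\<^sup>2"
  have l: "l > 0" using False by (simp add: l_def)
  \<comment> \<open>The tangent of \<open>u \<mapsto> u powr r\<close> at \<open>u = l\<close> is
    \<open>a * u + b\<close>; with \<open>u = t\<^sup>2\<close> it becomes the polynomial
    \<open>g\<close> in \<open>t\<close>.\<close>
  define a where "a = r * l powr (r - 1)"
  define b where "b = (1 - r) * l powr r"
  define g where "g = [:b, 0, a:]"
  have "poly g t \<le> t powr (2 * r)" if "t \<in> {0..onorm P}" for t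
  proof -
    have t: "t \<ge> 0" using that by simp
    define s where "s = t\<^sup>2 / l"
    have s: "s \<ge> 0" "t\<^sup>2 = s * l" using l by (auto simp: s_def)
    have "1 + r * (s - 1) \<le> s powr r" by (rule powr_ge_tangent[OF r s(1)])
    then have "(1 + r * (s - 1)) * l powr r \<le> s powr r * l powr r"
      by (intro mult_right_mono) auto
    also have "\<dots> = (t\<^sup>2) powr r" using s l by (simp add: powr_mult)
    also have "\<dots> = t powr (2 * r)"
      using t by (simp add: powr_powr flip: powr_numeral)
    also have "(1 + r * (s - 1)) * l powr r = poly g t"
    proof -
      have "a * t\<^sup>2 = r * s * (l powr (r - 1) * l)" using s by (simp add: a_def)
      also have "l powr (r - 1) * l = l powr r" using l by (simp add: powr_diff)
      finally show ?thesis by (simp add: g_def b_def power2_eq_square algebra_simps)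
    qed
    finally show ?thesis .
  qed
  then have "Re (cinner (poly_op g P x) x) \<le> Re (cinner (op_powr P (2 * r) x) x)"
    unfolding op_powr_def by (rule functional_calculus_cinner_ge[OF P f])
  also have "poly_op g P x = b *\<^sub>R x + a *\<^sub>R P (P x)"
    using l r by (simp add: g_def poly_op_def a_def numeral_2_eq_2)
  \<comment> \<open>By self-adjointness the quadratic form of \<open>P \<circ> P\<close> at
    \<open>x\<close> is \<open>l\<close>, the tangent point, where the minorant is exact.\<close>
  also have "Re (cinner (b *\<^sub>R x + a *\<^sub>R P (P x)) x) = b + a * l"
    by (simp add: cinner_add_left cinner_scaleR_left positive_op_cinner[OF P, of "P x"] cinner_self x l_def
        del: of_real_power)
  also have "\<dots> = l powr r"
  proof -
    have "l powr (r - 1) * l = l powr r" using l by (simp add: powr_diff)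
    then show ?thesis by (simp add: a_def b_def algebra_simps)
  qed
  also have "\<dots> = norm (P x) powr (2 * r)"
    by (simp add: l_def powr_powr flip: powr_numeral)
  finally show ?thesis .
qed

section \<open>Semi-Hilbertian spaces\<close>

lemma closure_range_sequential:
  fixes f :: "'a \<Rightarrow> 'b::first_countable_topology"
  assumes "y \<in> closure (range f)"
  obtains x where "(\<lambda>n. f (x n)) \<longlonglongrightarrow> y"
proof -
  obtain z where z: "\<And>n. z n \<in> range f" "z \<longlonglongrightarrow> y"
    using assms by (auto simp: closure_sequential)
  have "f (inv f (z n)) = z n" for n using z(1) by (rule f_inv_into_f)
  then show ?thesis using that[of "\<lambda>n. inv f (z n)"] z(2) by simp
qed

lemma is_completion_map_completion_map:
  fixes A :: "'a::complex_hilbert_space \<Rightarrow> 'a"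
  assumes "positive_op A"
  shows "is_completion_map A (completion_map A)"
proof -
  obtain J :: "'a \<Rightarrow> 'a" where "bounded_clinear J" "\<And>x y. cinner (J x) (J y) = cinner (A x) y"
    using positive_op_sqrt[OF assms] by blast
  then have "is_completion_map A J" by (simp add: is_completion_map_def A_inner_def)
  then show ?thesis unfolding completion_map_def by (rule someI[of "is_completion_map A"])
qed

lemma
  assumes "positive_op A"
  shows bounded_clinear_completion_map: "bounded_clinear (completion_map A)"
    and cinner_completion_map: "cinner (completion_map A x) (completion_map A y) = A_inner A x y"
  using is_completion_map_completion_map[OF assms] by (auto simp: is_completion_map_def)

lemma norm_completion_map:
  assumes "positive_op A"
  shows "norm (completion_map A x) = A_norm A x"
  by (simp add: A_norm_def flip: cinner_completion_map[OF assms])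
    (simp add: norm_eq_sqrt_inner inner_eq_Re_cinner)

lemma A_norm_nonneg: "positive_op A \<Longrightarrow> 0 \<le> A_norm A x"
  by (metis norm_completion_map norm_ge_zero)

lemma A_norm_scaleR: "positive_op A \<Longrightarrow> A_norm A (c *\<^sub>R x) = \<bar>c\<bar> * A_norm A x"
  using bounded_clinear_scaleR[OF bounded_clinear_completion_map, of A c x]
  by (simp flip: norm_completion_map)

lemma cmod_A_inner_le: "positive_op A \<Longrightarrow> cmod (A_inner A x y) \<le> A_norm A x * A_norm A y"
  using norm_cinner_le[of "completion_map A x" "completion_map A y"]
  by (simp add: cinner_completion_map norm_completion_map)

lemma A_norm_sq: "positive_op A \<Longrightarrow> A_inner A x x = of_real ((A_norm A x)\<^sup>2)"
  using cinner_self[of "completion_map A x"]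
  by (simp add: cinner_completion_map norm_completion_map)

text \<open>Existence: projecting any solution \<open>S\<close> onto
  \<open>closure (range A)\<close> does not change \<open>A \<circ> S\<close>. Uniqueness: the
  values of two solutions differ by a vector that lies both in the kernel of \<open>A\<close> and in
  \<open>closure (range A)\<close>, which are orthogonal.\<close>

lemma A_adjoint_props:
  fixes A T :: "'a::complex_hilbert_space \<Rightarrow> 'a"
  assumes A: "positive_op A" and T: "T \<in> B_A A"
  shows bounded_clinear_A_adjoint: "bounded_clinear (A_adjoint A T)"
    and A_inner_A_adjoint: "A_inner A (A_adjoint A T x) y = A_inner A x (T y)"
proof -
  let ?C = "\<lambda>S. bounded_clinear S \<and> A \<circ> S = cadjoint T \<circ> A \<and> range S \<subseteq> closure (range A)"
  have bA: "bounded_clinear A" using A by (simp add: positive_op_def)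
  have bT: "bounded_clinear T" using T by (simp add: B_A_def)
  obtain S where S: "bounded_clinear S" "A \<circ> S = cadjoint T \<circ> A" using T by (auto simp: B_A_def)
  have K: "closed (closure (range A))" "csubspace (closure (range A))"
    by (simp_all add: csubspace_closure csubspace_range[OF bA])
  obtain E where E: "bounded_clinear E" "range E \<subseteq> closure (range A)"
    "\<And>x y. y \<in> closure (range A) \<Longrightarrow> cinner (x - E x) y = 0"
    using corthogonal_projection[OF K] by metis
  have kerA: "A x = 0 \<longleftrightarrow> (\<forall>y\<in>closure (range A). cinner x y = 0)" for x
  proof
    assume "A x = 0"
    show "\<forall>y\<in>closure (range A). cinner x y = 0"
    proof
      fix y assume "y \<in> closure (range A)"
      then obtain z where z: "\<And>n. z n \<in> range A" "z \<longlonglongrightarrow> y" by (auto simp: closure_sequential)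
      have "cinner x (z n) = 0" for n
        using z(1)[of n] \<open>A x = 0\<close> by (auto simp flip: positive_op_cinner[OF A])
      moreover have "(\<lambda>n. cinner x (z n)) \<longlonglongrightarrow> cinner x y" by (intro tendsto_intros z)
      ultimately show "cinner x y = 0" by (simp add: LIMSEQ_const_iff)
    qed
  next
    assume "\<forall>y\<in>closure (range A). cinner x y = 0"
    then have "cinner (A x) y = 0" for y
      using closure_subset[of "range A"] by (auto simp: positive_op_cinner[OF A])
    then show "A x = 0" using cinner_ext[of "A x" 0] by simp
  qed
  have "A (x - E x) = 0" for x using kerA E(3) by blast
  then have "A (E x) = A x" for x by (simp add: bounded_clinear_diff[OF bA])
  then have "?C (E \<circ> S)"
    using S E(1,2) bounded_clinear_compose by (auto simp: fun_eq_iff)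
  moreover have "S1 = S2" if "?C S1" "?C S2" for S1 S2
  proof
    fix x
    have "A (S1 x) = A (S2 x)" using that by (metis comp_apply)
    then have "A (S1 x - S2 x) = 0" by (simp add: bounded_clinear_diff[OF bA])
    moreover have "S1 x - S2 x \<in> closure (range A)"
      using that K(2) by (intro subspace_diff) (auto simp: csubspace_def)
    ultimately have "cinner (S1 x - S2 x) (S1 x - S2 x) = 0" using kerA by blast
    then show "S1 x = S2 x" by (simp add: cinner_self)
  qed
  ultimately have "\<exists>!S. ?C S" by blast
  then have C: "?C (A_adjoint A T)" unfolding A_adjoint_def by (rule theI')
  then show "bounded_clinear (A_adjoint A T)" by blast
  have "A (A_adjoint A T x) = cadjoint T (A x)" using C by (metis comp_apply)
  then have "cinner (A x) (T y) = cnj (cinner y (A (A_adjoint A T x)))"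
    by (metis cinner_cadjoint[OF bT] cinner_commute)
  then show "A_inner A (A_adjoint A T x) y = A_inner A x (T y)"
    by (metis A_inner_def cinner_commute)
qed

text \<open>
  The numbers \<open>\<parallel>R\<^sup>n x\<parallel>\<^sub>A\<close> are log-convex in \<open>n\<close>, hence grow at least like \<open>(\<parallel>R x\<parallel>\<^sub>A / \<parallel>x\<parallel>\<^sub>A)\<^sup>n\<close>, but
  they are bounded by a multiple of \<open>\<parallel>R\<parallel>\<^sup>n\<close>.
\<close>

lemma A_norm_A_selfadjoint_le:
  assumes A: "positive_op A" and R: "bounded_clinear R"
    and sa: "\<And>x y. A_inner A (R x) y = A_inner A x (R y)"
  shows "A_norm A (R x) \<le> onorm R * A_norm A x"
proof -
  define a where "a n = A_norm A ((R ^^ n) x)" for n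
  define c where "c = onorm R"
  have c: "c \<ge> 0" using R by (simp add: c_def onorm_nonneg)
  have a0: "a n \<ge> 0" for n by (simp add: a_def A_norm_nonneg[OF A])
  \<comment> \<open>Cauchy-Schwarz after moving one \<open>R\<close> across the
    \<open>A\<close>-inner product.\<close>
  have conv: "(a (Suc n))\<^sup>2 \<le> a n * a (Suc (Suc n))" for n
  proof -
    have "of_real ((a (Suc n))\<^sup>2) = A_inner A ((R ^^ n) x) ((R ^^ Suc (Suc n)) x)"
      unfolding a_def A_norm_sq[OF A, symmetric] by (simp add: sa)
    then have "(a (Suc n))\<^sup>2 = cmod (A_inner A ((R ^^ n) x) ((R ^^ Suc (Suc n)) x))"
      by (metis abs_of_nonneg norm_of_real zero_le_power2)
    then show ?thesis unfolding a_def by (metis cmod_A_inner_le[OF A])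
  qed
  have bound: "a n \<le> onorm (completion_map A) * norm x * c ^ n" for n
  proof -
    have J: "bounded_clinear (completion_map A)" by (rule bounded_clinear_completion_map[OF A])
    have "norm ((R ^^ n) x) \<le> norm x * c ^ n"
    proof (induction n)
      case (Suc n)
      have "norm ((R ^^ Suc n) x) \<le> c * norm ((R ^^ n) x)"
        using norm_bounded_clinear_le[OF R] by (simp add: c_def)
      also have "\<dots> \<le> c * (norm x * c ^ n)" using Suc c by (intro mult_left_mono)
      finally show ?case by (simp add: algebra_simps)
    qed simp
    moreover have "a n \<le> onorm (completion_map A) * norm ((R ^^ n) x)"
      unfolding a_def norm_completion_map[OF A, symmetric] by (rule norm_bounded_clinear_le[OF J])
    ultimately show ?thesis
      using mult_left_mono[OF _ onorm_nonneg[OF J]] by (fastforce simp: mult.assoc)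
  qed
  show ?thesis
  proof (rule ccontr)
    assume "\<not> ?thesis"
    then have gt: "c * a 0 < a 1" by (simp add: a_def c_def)
    then have "a 1 > 0" using c a0[of 0] by (meson mult_nonneg_nonneg order.strict_trans1)
    then have "a 0 > 0" using conv[of 0] a0[of 0] by (cases "a 0 = 0") auto
    define q where "q = a 1 / a 0"
    have q: "q > c" "q > 0" using gt \<open>a 0 > 0\<close> \<open>a 1 > 0\<close> by (auto simp: q_def field_simps)
    have step: "a n > 0 \<and> q * a n \<le> a (Suc n)" for n
    proof (induction n)
      case (Suc n)
      then have pos: "a (Suc n) > 0" using q(2) by (meson less_le_trans mult_pos_pos)
      have "q * a (Suc n) * a n \<le> (a (Suc n))\<^sup>2"
        using Suc pos by (simp add: power2_eq_square mult.commute mult.left_commute)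
      also have "\<dots> \<le> a (Suc (Suc n)) * a n" using conv[of n] by (simp add: mult.commute)
      finally show ?case using Suc pos by simp
    qed (use \<open>a 0 > 0\<close> in \<open>simp add: q_def\<close>)
    have grow: "a 0 * q ^ n \<le> a n" for n
    proof (induction n)
      case (Suc n)
      have "a 0 * q ^ Suc n = q * (a 0 * q ^ n)" by simp
      also have "\<dots> \<le> q * a n" using Suc q(2) by (intro mult_left_mono) auto
      finally show ?case using step[of n] by linarith
    qed simp
    \<comment> \<open>A base strictly between \<open>c\<close> and \<open>q\<close> that is positive
      even when \<open>c = 0\<close>, so that powers of \<open>q\<close> can be divided by powers of
      it.\<close>
    define d where "d = (c + q) / 2"
    have d: "c < d" "0 < d" "d < q" using q c by (auto simp: d_def)
    define B where "B = onorm (completion_map A) * norm x / a 0"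
    have "(q / d) ^ n \<le> B" for n
    proof -
      have B0: "0 \<le> B" unfolding B_def using \<open>a 0 > 0\<close>
        by (simp add: onorm_nonneg bounded_clinear_completion_map[OF A])
      have "q ^ n \<le> B * c ^ n"
        using order_trans[OF grow bound, of n] \<open>a 0 > 0\<close> by (simp add: B_def field_simps)
      also have "\<dots> \<le> B * d ^ n" using d c B0 by (intro mult_left_mono power_mono) auto
      finally show ?thesis using d by (simp add: power_divide field_simps)
    qed
    moreover have "1 < q / d" using d by simp
    ultimately show False using real_arch_pow[of "q / d" B] by (meson not_le)
  qed
qed

text \<open>For an \<open>A\<close>-selfadjoint \<open>R\<close>, the assignment \<open>J x \<mapsto> J (R x)\<close> is well defined and bounded, so it
  extends to \<open>closure (range J)\<close>.\<close>

lemma induced_op_props: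
  fixes A R :: "'a::complex_hilbert_space \<Rightarrow> 'a"
  assumes A: "positive_op A" and R: "bounded_clinear R"
    and sa: "\<And>x y. A_inner A (R x) y = A_inner A x (R y)"
  defines "J \<equiv> completion_map A"
  shows bounded_clinear_induced_op: "bounded_clinear (induced_op A R)"
    and induced_op_completion_map: "induced_op A R (J x) = J (R x)"
    and induced_op_orthogonal: "(\<And>x. cinner (J x) y = 0) \<Longrightarrow> induced_op A R y = 0"
proof -
  let ?C = "\<lambda>P. bounded_clinear P \<and> (\<forall>x. P (J x) = J (R x)) \<and>
     (\<forall>y. (\<forall>x. cinner (J x) y = 0) \<longrightarrow> P y = 0)"
  have bJ: "bounded_clinear J" unfolding J_def by (rule bounded_clinear_completion_map[OF A])
  define K where "K = closure (range J)"
  have K: "closed K" "csubspace K" "range J \<subseteq> K"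
    by (simp_all add: K_def csubspace_closure csubspace_range[OF bJ] closure_subset)
  obtain E where E: "bounded_clinear E" "range E \<subseteq> K"
    "\<And>x y. y \<in> K \<Longrightarrow> cinner (x - E x) y = 0" "\<And>x. x \<in> K \<Longrightarrow> E x = x"
    "\<And>x. (\<And>y. y \<in> K \<Longrightarrow> cinner y x = 0) \<Longrightarrow> E x = 0" "\<And>x. norm (E x) \<le> norm x"
    using corthogonal_projection[OF K(1,2)] by metis
  have orthK: "cinner y x = 0" if "\<And>z. cinner (J z) x = 0" "y \<in> K" for x y
  proof -
    obtain z where "(\<lambda>n. J (z n)) \<longlonglongrightarrow> y"
      using \<open>y \<in> K\<close> unfolding K_def by (rule closure_range_sequential)
    then have "(\<lambda>n. cinner (J (z n)) x) \<longlonglongrightarrow> cinner y x" by (intro tendsto_intros)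
    then show ?thesis by (simp add: that(1) LIMSEQ_const_iff)
  qed
  define c where "c = onorm R"
  have c: "c \<ge> 0" using R by (simp add: c_def onorm_nonneg)
  have le: "norm (J (R x)) \<le> c * norm (J x)" for x
    using A_norm_A_selfadjoint_le[OF A R sa] by (simp add: J_def c_def norm_completion_map[OF A])
  have dist_le: "dist (J (R x)) (J (R y)) \<le> c * dist (J x) (J y)" for x y
    using le[of "x - y"] by (simp add: dist_norm bounded_clinear_diff[OF bJ] bounded_clinear_diff[OF R])
  \<comment> \<open>\<open>inv J\<close> picks a preimage; by \<open>dist_le\<close> the value does
    not depend on the choice.\<close>
  define f where "f y = J (R (inv J y))" for y
  have f: "f (J x) = J (R x)" for x
  proof -
    have "J (inv J (J x)) = J x" by (simp add: f_inv_into_f)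
    then show ?thesis using dist_le[of "inv J (J x)" x] by (simp add: f_def)
  qed
  have "uniformly_continuous_on (range J) f"
    unfolding uniformly_continuous_on_def
  proof (intro allI impI)
    fix e :: real assume e: "e > 0"
    have "dist (f y) (f x) < e" if "x \<in> range J" "y \<in> range J" "dist y x < e / (c + 1)" for x y
    proof -
      have "dist (f y) (f x) \<le> c * dist y x" using that(1,2) dist_le by (auto simp: f)
      also have "\<dots> \<le> (c + 1) * dist y x" by (intro mult_right_mono) auto
      also have "\<dots> < e" using that(3) c by (simp add: field_simps)
      finally show ?thesis .
    qed
    then show "\<exists>d>0. \<forall>x\<in>range J. \<forall>x'\<in>range J. dist x' x < d \<longrightarrow> dist (f x') (f x) < e"
      using e c by (intro exI[of _ "e / (c + 1)"]) auto
  qed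
  then obtain g where g: "uniformly_continuous_on K g" "\<And>x. x \<in> range J \<Longrightarrow> f x = g x"
    unfolding K_def by (rule uniformly_continuous_on_extension_on_closure) blast
  have gJ: "g (J x) = J (R x)" for x using g(2)[of "J x"] f by simp
  have lim: "(\<lambda>n. J (R (x n))) \<longlonglongrightarrow> g y" if "(\<lambda>n. J (x n)) \<longlonglongrightarrow> y" for x y
  proof -
    have "y \<in> K" unfolding K_def closure_sequential
      by (intro exI[of _ "\<lambda>n. J (x n)"]) (simp add: that)
    then have "(\<lambda>n. g (J (x n))) \<longlonglongrightarrow> g y"
      using uniformly_continuous_imp_continuous[OF g(1)] that K(3)
      by (intro continuous_on_tendsto_compose[of K g]) (auto simp: range_subsetD)
    then show ?thesis by (simp add: gJ)
  qed
  have seq: "\<exists>x. (\<lambda>n. J (x n)) \<longlonglongrightarrow> y" if y: "y \<in> K" for y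
    using closure_range_sequential[OF y[unfolded K_def]] by blast
  \<comment> \<open>Composition with the projection makes the operator vanish on the orthogonal
    complement of \<open>K\<close>.\<close>
  define P where "P = g \<circ> E"
  have "bounded_clinear P"
  proof (rule bounded_clinearI)
    fix u v :: 'a and k
    have EK: "E w \<in> K" for w using E(2) by auto
    obtain x y where x: "(\<lambda>n. J (x n)) \<longlonglongrightarrow> E u" and y: "(\<lambda>n. J (y n)) \<longlonglongrightarrow> E v"
      using seq[OF EK] by metis
    have "(\<lambda>n. J (x n + y n)) \<longlonglongrightarrow> E u + E v"
      unfolding bounded_clinear_add[OF bJ] by (intro tendsto_intros x y)
    then have "(\<lambda>n. J (R (x n)) + J (R (y n))) \<longlonglongrightarrow> g (E u + E v)"
      using lim[of "\<lambda>n. x n + y n"]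
      by (simp add: bounded_clinear_add[OF bJ] bounded_clinear_add[OF R])
    moreover have "(\<lambda>n. J (R (x n)) + J (R (y n))) \<longlonglongrightarrow> g (E u) + g (E v)"
      by (intro tendsto_intros lim x y)
    ultimately show "P (u + v) = P u + P v"
      by (simp add: P_def bounded_clinear_add[OF E(1)] LIMSEQ_unique)
    have "(\<lambda>n. J (k *\<^sub>C x n)) \<longlonglongrightarrow> k *\<^sub>C E u"
      unfolding bounded_clinear_scaleC[OF bJ] by (intro tendsto_intros x)
    then have "(\<lambda>n. k *\<^sub>C J (R (x n))) \<longlonglongrightarrow> g (k *\<^sub>C E u)"
      using lim[of "\<lambda>n. k *\<^sub>C x n"]
      by (simp add: bounded_clinear_scaleC[OF bJ] bounded_clinear_scaleC[OF R])
    moreover have "(\<lambda>n. k *\<^sub>C J (R (x n))) \<longlonglongrightarrow> k *\<^sub>C g (E u)"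
      by (intro tendsto_intros lim x)
    ultimately show "P (k *\<^sub>C u) = k *\<^sub>C P u"
      by (simp add: P_def bounded_clinear_scaleC[OF E(1)] LIMSEQ_unique)
    have "(\<lambda>n. norm (J (R (x n)))) \<longlonglongrightarrow> norm (g (E u))" by (intro tendsto_intros lim x)
    moreover have "(\<lambda>n. c * norm (J (x n))) \<longlonglongrightarrow> c * norm (E u)" by (intro tendsto_intros x)
    ultimately have "norm (g (E u)) \<le> c * norm (E u)" by (rule LIMSEQ_le) (use le in auto)
    also have "\<dots> \<le> c * norm u" using c E(6) by (intro mult_left_mono) auto
    finally show "norm (P u) \<le> norm u * c" by (simp add: P_def mult.commute)
  qed
  moreover have "P (J x) = J (R x)" for x using K(3) by (simp add: P_def E(4) gJ range_subsetD)
  moreover have "P y = 0" if "\<forall>x. cinner (J x) y = 0" for y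
  proof -
    have "E y = 0" using that orthK by (intro E(5)) blast
    moreover have "g 0 = 0" using gJ[of 0] by (simp add: bounded_clinear_zero[OF bJ] bounded_clinear_zero[OF R])
    ultimately show ?thesis by (simp add: P_def)
  qed
  ultimately have "?C P" by blast
  \<comment> \<open>Candidates agree on \<open>range J\<close>, by continuity on \<open>K\<close>,
    and all vanish on its orthogonal complement; \<open>y\<close> splits into \<open>E y\<close> and
    \<open>y - E y\<close>.\<close>
  moreover have "P1 = P2" if P1: "?C P1" and P2: "?C P2" for P1 P2
  proof
    fix y
    have b: "bounded_clinear P1" "bounded_clinear P2" using P1 P2 by auto
    have "E y \<in> K" using E(2) by auto
    then obtain x where x: "(\<lambda>n. J (x n)) \<longlonglongrightarrow> E y" using seq by blast
    have "(\<lambda>n. P1 (J (x n))) \<longlonglongrightarrow> P1 (E y)" "(\<lambda>n. P2 (J (x n))) \<longlonglongrightarrow> P2 (E y)"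
      by (rule bounded_linear.tendsto[OF bounded_clinear_bounded_linear x], rule b)+
    then have eq: "P1 (E y) = P2 (E y)" using P1 P2 by (simp add: LIMSEQ_unique)
    have "cinner (J x) (y - E y) = 0" for x
      using E(3)[of "J x" y] K(3) cinner_commute[of "J x" "y - E y"] by auto
    then have "P1 (y - E y) = 0" "P2 (y - E y) = 0" using P1 P2 by blast+
    then show "P1 y = P2 y" using eq by (simp add: bounded_clinear_diff b)
  qed
  ultimately have "\<exists>!P. ?C P" by blast
  then have "?C (induced_op A R)" unfolding induced_op_def J_def by (rule theI')
  then show "bounded_clinear (induced_op A R)" "induced_op A R (J x) = J (R x)"
    "(\<And>x. cinner (J x) y = 0) \<Longrightarrow> induced_op A R y = 0" by auto
qed

text \<open>On \<open>range J\<close> the quadratic form of the induced operator is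
  \<open>A_inner A (R x) x\<close>, and limits extend its positivity to \<open>K\<close>. The
  orthogonal complement contributes nothing, since the operator vanishes there and maps
  \<open>K\<close> into \<open>K\<close>.\<close>

lemma positive_op_induced_op:
  fixes A R :: "'a::complex_hilbert_space \<Rightarrow> 'a"
  assumes A: "positive_op A" and R: "bounded_clinear R"
    and sa: "\<And>x y. A_inner A (R x) y = A_inner A x (R y)"
    and pos: "\<And>x. 0 \<le> Re (A_inner A (R x) x)"
  shows "positive_op (induced_op A R)"
proof -
  define J where "J = completion_map A"
  define P where "P = induced_op A R"
  have bJ: "bounded_clinear J" unfolding J_def by (rule bounded_clinear_completion_map[OF A])
  have bP: "bounded_clinear P" unfolding P_def by (rule bounded_clinear_induced_op[OF A R sa])
  have PJ: "P (J x) = J (R x)" for x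
    unfolding P_def J_def by (rule induced_op_completion_map[OF A R sa])
  define K where "K = closure (range J)"
  have K: "closed K" "csubspace K" "range J \<subseteq> K"
    by (simp_all add: K_def csubspace_closure csubspace_range[OF bJ] closure_subset)
  obtain E where E: "range E \<subseteq> K" "\<And>x y. y \<in> K \<Longrightarrow> cinner (x - E x) y = 0"
    using corthogonal_projection[OF K(1,2)] by metis
  have "cinner (P y) y \<in> \<real> \<and> 0 \<le> Re (cinner (P y) y)" for y
  proof -
    have "E y \<in> K" using E(1) by auto
    then obtain x where lim_x: "(\<lambda>n. J (x n)) \<longlonglongrightarrow> E y"
      unfolding K_def by (rule closure_range_sequential)
    define z where "z n = J (x n)" for n
    have x: "z n = J (x n)" for n by (simp add: z_def)
    have z: "z \<longlonglongrightarrow> E y" using lim_x by (simp add: z_def[abs_def])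
    have Plim: "(\<lambda>n. P (z n)) \<longlonglongrightarrow> P (E y)"
      by (rule bounded_linear.tendsto[OF bounded_clinear_bounded_linear[OF bP] z])
    have PK: "P (E y) \<in> K"
      unfolding K_def closure_sequential
      using Plim by (intro exI[of _ "\<lambda>n. P (z n)"]) (simp add: x PJ)
    have "cinner (P (E y)) (y - E y) = 0"
      using E(2)[OF PK, of y] cinner_commute[of "P (E y)" "y - E y"] by simp
    moreover have "P (y - E y) = 0"
      unfolding P_def
    proof (rule induced_op_orthogonal[OF A R sa])
      fix w show "cinner (completion_map A w) (y - E y) = 0"
        using E(2)[of "J w" y] K(3) cinner_commute[of "J w" "y - E y"] by (auto simp: J_def)
    qed
    ultimately have eq: "cinner (P y) y = cinner (P (E y)) (E y)"
      using bounded_clinear_diff[OF bP, of y "E y"] by (simp add: cinner_diff_right)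
    have lim: "(\<lambda>n. cinner (P (z n)) (z n)) \<longlonglongrightarrow> cinner (P y) y"
      unfolding eq by (intro tendsto_intros Plim z)
    have val: "cinner (P (z n)) (z n) = A_inner A (R (x n)) (x n)" for n
      by (simp add: x PJ) (simp add: J_def cinner_completion_map[OF A])
    have "Im (A_inner A (R u) u) = 0" for u
    proof -
      have "A_inner A (R u) u = cnj (A_inner A (R u) u)"
        using sa[of u u] positive_op_cinner[OF A, of u "R u"] cinner_commute[of u "A (R u)"]
        by (simp add: A_inner_def)
      then show ?thesis by (simp add: complex_eq_iff)
    qed
    then have "Im (cinner (P (z n)) (z n)) = 0" "0 \<le> Re (cinner (P (z n)) (z n))" for n
      unfolding val using pos by auto
    moreover have "(\<lambda>n. Im (cinner (P (z n)) (z n))) \<longlonglongrightarrow> Im (cinner (P y) y)"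
      "(\<lambda>n. Re (cinner (P (z n)) (z n))) \<longlonglongrightarrow> Re (cinner (P y) y)"
      by (intro tendsto_intros lim)+
    ultimately have "Im (cinner (P y) y) = 0" "0 \<le> Re (cinner (P y) y)"
      by (simp add: LIMSEQ_const_iff, blast intro: LIMSEQ_le_const)
    then show ?thesis by (simp add: complex_is_Real_iff)
  qed
  then show ?thesis using bP by (simp add: positive_op_def P_def)
qed

section \<open>The numerical radius inequality\<close>

lemma A_inner_commute:
  assumes "positive_op A"
  shows "A_inner A x y = cnj (A_inner A y x)"
  using cinner_commute[of "completion_map A x" "completion_map A y"]
  by (simp add: cinner_completion_map[OF assms])

lemma A_adjoint_comp_props:
  fixes A T :: "'a::complex_hilbert_space \<Rightarrow> 'a"
  assumes A: "positive_op A" and T: "T \<in> B_A A"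
  defines "R \<equiv> A_adjoint A T \<circ> T"
  shows A_inner_A_adjoint_comp: "A_inner A (R x) y = A_inner A (T x) (T y)"
    and bounded_clinear_A_adjoint_comp: "bounded_clinear R"
    and A_selfadjoint_A_adjoint_comp: "A_inner A (R x) y = A_inner A x (R y)"
    and A_positive_A_adjoint_comp: "0 \<le> Re (A_inner A (R x) x)"
proof -
  have eq: "A_inner A (R x) y = A_inner A (T x) (T y)" for x y
    by (simp add: R_def A_inner_A_adjoint[OF A T])
  then show "A_inner A (R x) y = A_inner A (T x) (T y)" .
  show "bounded_clinear R"
    unfolding R_def using T by (intro bounded_clinear_compose bounded_clinear_A_adjoint A)
      (simp_all add: B_A_def)
  show "A_inner A (R x) y = A_inner A x (R y)"
    using A_inner_commute[OF A, of x "R y"] A_inner_commute[OF A, of "T x" "T y"] by (simp add: eq)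
  show "0 \<le> Re (A_inner A (R x) x)"
    by (simp add: eq A_norm_sq[OF A] del: of_real_power)
qed

lemma bounded_clinear_op_powr:
  assumes "positive_op P" "0 < s"
  shows "bounded_clinear (op_powr P s)"
  unfolding op_powr_def using assms
  by (intro bounded_clinear_functional_calculus continuous_on_powr' continuous_intros) auto

text \<open>The vector \<open>2\<langle>a, e\<rangle>e - a\<close> is a reflection of \<open>a\<close>, so it has the norm of \<open>a\<close>.\<close>

lemma Buzano_inequality:
  assumes e: "norm e = 1"
  shows "cmod (cinner a e) * cmod (cinner b e) \<le> (norm a * norm b + cmod (cinner a b)) / 2"
proof -
  define z where "z = cinner a e"
  define a' where "a' = (2 * z) *\<^sub>C e - a"
  have "cinner a' a' = cinner a a"
    using e cinner_commute[of e a]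
    by (simp add: a'_def cinner_diff_left cinner_diff_right cinner_scaleC_left cinner_scaleC_right
        cinner_self[of e] algebra_simps flip: z_def)
  then have "norm a' = norm a" by (simp add: cinner_self flip: of_real_power)
  have "2 * (cmod z * cmod (cinner b e)) = cmod (2 * z * cinner e b)"
    using cinner_commute[of e b] by (simp add: norm_mult)
  also have "\<dots> = cmod (cinner a' b + cinner a b)"
    by (simp add: a'_def cinner_diff_left cinner_scaleC_left)
  also have "\<dots> \<le> norm a' * norm b + cmod (cinner a b)"
    using norm_cinner_le[of a' b] norm_triangle_ineq[of "cinner a' b" "cinner a b"] by linarith
  finally show ?thesis using \<open>norm a' = norm a\<close> by (simp add: z_def)
qed

text \<open>The tangent bounds at the mean \<open>m\<close>, rescaled by \<open>m powr p\<close>,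
  are added for \<open>a\<close> and \<open>b\<close>; their linear terms cancel.\<close>

lemma powr_mean_le:
  fixes a b p :: real
  assumes "0 \<le> a" "0 \<le> b" "1 \<le> p"
  shows "((a + b) / 2) powr p \<le> (a powr p + b powr p) / 2"
proof (cases "a + b = 0")
  case False
  define m where "m = (a + b) / 2"
  have m: "m > 0" using False assms by (simp add: m_def)
  have le: "m powr p * (1 + p * (x / m - 1)) \<le> x powr p" if "x \<ge> 0" for x
  proof -
    have "m powr p * (1 + p * (x / m - 1)) \<le> m powr p * (x / m) powr p"
      using powr_ge_tangent[of p "x / m"] assms that m by (intro mult_left_mono) auto
    also have "\<dots> = x powr p" using m that by (simp flip: powr_mult)
    finally show ?thesis .
  qed
  have sum: "(a + b) / m = 2" using m by (subst divide_eq_eq) (simp add: m_def)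
  have eq: "m powr p * (1 + p * (a / m - 1)) + m powr p * (1 + p * (b / m - 1))
      = m powr p * (2 + p * ((a + b) / m - 2))"
    by (simp add: algebra_simps add_divide_distrib)
  show ?thesis using le[OF assms(1)] le[OF assms(2)] eq[unfolded sum]
    unfolding m_def[symmetric] by simp
next
  case True
  then have "a = 0" "b = 0" using assms by auto
  then show ?thesis by simp
qed

section \<open>The estimate for one pair of entries\<close>

lemma A_inner_powr_le:
  fixes A T S :: "'a::complex_hilbert_space \<Rightarrow> 'a"
  assumes A: "positive_op A" and T: "T \<in> B_A A" and S: "S \<in> B_A A"
    and \<beta>: "\<beta> \<ge> 0" and r: "r \<ge> 1" and x: "A_norm A x = 1"
  defines "\<phi> \<equiv> A_norm_powr_sum A (2 * r) (A_adjoint A T \<circ> T) (A_adjoint A S \<circ> S)"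
    and "\<rho> \<equiv> A_numerical_radius A (A_adjoint A S \<circ> S \<circ> A_adjoint A T \<circ> T) powr r"
  shows "cmod (A_inner A (T x) (S x)) powr (4 * r)
    \<le> (1 + 2 * \<beta>) / (8 * (\<beta> + 1)) * \<phi>\<^sup>2 + 1 / (2 * (\<beta> + 1)) * \<rho>\<^sup>2"
proof -
  define T' where "T' = A_adjoint A T \<circ> T"
  define S' where "S' = A_adjoint A S \<circ> S"
  note T'_props = A_adjoint_comp_props[OF A T, folded T'_def]
  note S'_props = A_adjoint_comp_props[OF A S, folded S'_def]
  define P where "P = induced_op A T'"
  define Q where "Q = induced_op A S'"
  let ?J = "completion_map A"
  have PJ: "P (?J y) = ?J (T' y)" and QJ: "Q (?J y) = ?J (S' y)" for y
    unfolding P_def Q_def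
    using T'_props(2,3) S'_props(2,3) by (blast intro: induced_op_completion_map[OF A])+
  have P: "positive_op P" and Q: "positive_op Q"
    unfolding P_def Q_def
    using T'_props(2,3,4) S'_props(2,3,4) by (blast intro: positive_op_induced_op[OF A])+
  have bP: "bounded_clinear P" and bQ: "bounded_clinear Q"
    using P Q by (auto simp: positive_op_def)
  define e where "e = ?J x"
  have e: "norm e = 1" by (simp add: e_def norm_completion_map[OF A] x)
  define u where "u = norm (P e)"
  define v where "v = norm (Q e)"
  define w where "w = cmod (cinner (P e) (Q e))"
  define U where "U = u powr (2 * r)"
  define V where "V = v powr (2 * r)"
  define W where "W = w powr (2 * r)"
  have w_le: "w \<le> u * v" unfolding w_def u_def v_def by (rule norm_cinner_le)
  have nonneg: "0 \<le> u" "0 \<le> v" "0 \<le> w" by (auto simp: u_def v_def w_def)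

  \<comment> \<open>McCarthy's inequality for both operators at the same unit vector bounds the
    quadratic form of the sum of powers from below, and hence its norm.\<close>
  have "\<phi> \<ge> U + V"
  proof -
    define F where "F y = op_powr P (2 * r) y + op_powr Q (2 * r) y" for y
    have bF: "bounded_clinear F"
      unfolding F_def using r by (intro bounded_clinear_plus bounded_clinear_op_powr P Q) auto
    have "U + V \<le> Re (cinner (F e) e)"
      unfolding U_def V_def u_def v_def F_def cinner_add_left plus_complex.simps
      by (intro add_mono op_powr_cinner_ge P Q r e)
    also have "\<dots> \<le> norm (F e) * norm e"
      using norm_cinner_le complex_Re_le_cmod order_trans by blast
    also have "\<dots> \<le> onorm F" using norm_bounded_clinear_le[OF bF, of e] e by simp
    finally show ?thesis
      by (simp add: \<phi>_def A_norm_powr_sum_def F_def[abs_def] P_def Q_def T'_def S'_def)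
  qed
  moreover have "0 \<le> U" "0 \<le> V" by (auto simp: U_def V_def)
  ultimately have "(U + V)\<^sup>2 \<le> \<phi>\<^sup>2" by (intro power_mono) auto
  moreover have "4 * (U * V) \<le> (U + V)\<^sup>2"
    using zero_le_power2[of "U - V"] by (simp add: power2_eq_square algebra_simps)
  ultimately have UV: "U * V \<le> \<phi>\<^sup>2 / 4" by simp

  \<comment> \<open>\<open>A\<close>-selfadjointness moves \<open>S'\<close> across, so that
    \<open>w\<close> is one of the values over which the numerical radius in \<open>\<rho>\<close>
    is a supremum.\<close>
  have val: "A_inner A ((A_adjoint A S \<circ> S \<circ> A_adjoint A T \<circ> T) y) y
      = cinner (P (?J y)) (Q (?J y))" for y
  proof -
    have "A_inner A (S' (T' y)) y = A_inner A (T' y) (S' y)" by (rule S'_props(3))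
    then show ?thesis by (simp add: PJ QJ cinner_completion_map[OF A] T'_def S'_def)
  qed
  have "w \<le> A_numerical_radius A (A_adjoint A S \<circ> S \<circ> A_adjoint A T \<circ> T)"
    unfolding A_numerical_radius_def val
  proof (rule cSup_upper)
    show "w \<in> insert 0 {cmod (cinner (P (?J x)) (Q (?J x))) |x. A_norm A x = 1}"
      using x by (auto simp: w_def e_def)
    show "bdd_above (insert 0 {cmod (cinner (P (?J x)) (Q (?J x))) |x. A_norm A x = 1})"
    proof (rule bdd_aboveI)
      fix k assume "k \<in> insert 0 {cmod (cinner (P (?J x)) (Q (?J x))) |x. A_norm A x = 1}"
      then consider "k = 0" | y where "k = cmod (cinner (P (?J y)) (Q (?J y)))" "A_norm A y = 1"
        by blast
      then show "k \<le> onorm P * onorm Q"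
      proof cases
        case 2
        have "k \<le> norm (P (?J y)) * norm (Q (?J y))" unfolding 2(1) by (rule norm_cinner_le)
        also have "\<dots> \<le> onorm P * onorm Q"
          using norm_bounded_clinear_le[OF bP, of "?J y"] norm_bounded_clinear_le[OF bQ, of "?J y"] 2(2)
          by (intro mult_mono) (auto simp: norm_completion_map[OF A] onorm_nonneg bP bQ)
        finally show ?thesis .
      qed (simp add: onorm_nonneg bP bQ)
    qed
  qed
  then have "w powr r \<le> \<rho>" unfolding \<rho>_def using nonneg r by (intro powr_mono2) auto
  then have "(w powr r)\<^sup>2 \<le> \<rho>\<^sup>2" by (intro power_mono) auto
  moreover have "(w powr r)\<^sup>2 = W"
    by (simp add: W_def power2_eq_square flip: powr_add)
  ultimately have W: "W \<le> \<rho>\<^sup>2" by simp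

  define a where "a = cmod (cinner (P e) e) * cmod (cinner (Q e) e)"
  have "a \<ge> 0" by (simp add: a_def)
  have a_le: "a \<le> (u * v + w) / 2"
    unfolding a_def u_def v_def w_def by (rule Buzano_inequality[OF e])
  then have "2 * a \<le> u * v + w" by simp
  then have a_le': "a \<le> u * v" using w_le by linarith
  have "a powr (2 * r) \<le> (u * v) powr (2 * r)"
    using a_le' \<open>a \<ge> 0\<close> r by (intro powr_mono2) auto
  then have 1: "a powr (2 * r) \<le> U * V" using nonneg by (simp add: U_def V_def powr_mult)
  have "a powr (2 * r) \<le> ((u * v + w) / 2) powr (2 * r)"
    using a_le \<open>a \<ge> 0\<close> r by (intro powr_mono2) auto
  also have "\<dots> \<le> ((u * v) powr (2 * r) + w powr (2 * r)) / 2"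
    using nonneg r by (intro powr_mean_le) auto
  finally have 2: "a powr (2 * r) \<le> (U * V + W) / 2"
    using nonneg by (simp add: U_def V_def W_def powr_mult)

  have "(cmod (A_inner A (T x) (S x)))\<^sup>2 \<le> (A_norm A (T x) * A_norm A (S x))\<^sup>2"
    by (intro power_mono cmod_A_inner_le A) auto
  also have "\<dots> = a"
  proof -
    have "cmod (cinner (P e) e) = (A_norm A (T x))\<^sup>2" "cmod (cinner (Q e) e) = (A_norm A (S x))\<^sup>2"
      unfolding e_def PJ QJ cinner_completion_map[OF A] T'_props(1) S'_props(1) A_norm_sq[OF A]
      by (simp_all add: norm_power)
    then show ?thesis by (simp add: a_def power_mult_distrib)
  qed
  finally have "((cmod (A_inner A (T x) (S x)))\<^sup>2) powr (2 * r) \<le> a powr (2 * r)"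
    using r by (intro powr_mono2) auto
  also have "((cmod (A_inner A (T x) (S x)))\<^sup>2) powr (2 * r) = cmod (A_inner A (T x) (S x)) powr (4 * r)"
    by (simp add: powr_powr flip: powr_numeral)
  \<comment> \<open>The convex combination of the bounds \<open>1\<close> and \<open>2\<close> with
    weights \<open>\<beta> / (\<beta> + 1)\<close> and \<open>1 / (\<beta> + 1)\<close>.\<close>
  also have "a powr (2 * r) \<le> (\<beta> * (U * V) + (U * V + W) / 2) / (\<beta> + 1)"
    using mult_left_mono[OF 1 \<beta>] 2 \<beta> by (simp add: field_simps)
  also have "\<beta> * (U * V) + (U * V + W) / 2 = ((1 + 2 * \<beta>) * (U * V) + W) / 2"
    by (simp add: field_simps)
  also have "\<dots> / (\<beta> + 1) = (1 + 2 * \<beta>) / (2 * (\<beta> + 1)) * (U * V) + 1 / (2 * (\<beta> + 1)) * W"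
  proof -
    have "(k * X + W) / 2 / d = k / (2 * d) * X + 1 / (2 * d) * W" for k X d :: real
      by (simp add: add_divide_distrib)
    then show ?thesis .
  qed
  \<comment> \<open>The factor \<open>1 / 4\<close> in \<open>UV\<close> turns the denominator
    \<open>2 * (\<beta> + 1)\<close> into \<open>8 * (\<beta> + 1)\<close>.\<close>
  also have "\<dots> \<le> (1 + 2 * \<beta>) / (2 * (\<beta> + 1)) * (\<phi>\<^sup>2 / 4) + 1 / (2 * (\<beta> + 1)) * \<rho>\<^sup>2"
    using \<beta> UV W by (intro add_mono mult_left_mono) auto
  finally show ?thesis by simp
qed

section \<open>Block operators on the direct sum\<close>

lemma bounded_clinear_block_op:
  assumes "bounded_clinear T11" "bounded_clinear T12" "bounded_clinear T21" "bounded_clinear T22"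
  shows "bounded_clinear (block_op T11 T12 T21 T22)"
proof (rule bounded_clinearI)
  show "block_op T11 T12 T21 T22 (z + w) = block_op T11 T12 T21 T22 z + block_op T11 T12 T21 T22 w"
    for z w
    by (simp add: block_op_def case_prod_beta assms[THEN bounded_clinear_add])
  show "block_op T11 T12 T21 T22 (c *\<^sub>C z) = c *\<^sub>C block_op T11 T12 T21 T22 z" for c z
    by (simp add: block_op_def case_prod_beta scaleC_prod_def scaleC_add_right
        assms[THEN bounded_clinear_scaleC])
  show "norm (block_op T11 T12 T21 T22 z) \<le> norm z * (onorm T11 + onorm T12 + onorm T21 + onorm T22)"
    for z
  proof -
    have "norm (block_op T11 T12 T21 T22 z)
        \<le> norm (T11 (fst z)) + norm (T12 (snd z)) + (norm (T21 (fst z)) + norm (T22 (snd z)))"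
      unfolding block_op_def case_prod_beta
      by (intro order_trans[OF norm_Pair_le] add_mono norm_triangle_ineq)
    also have "\<dots> \<le> norm z * onorm T11 + norm z * onorm T12 + (norm z * onorm T21 + norm z * onorm T22)"
      using norm_fst_le[of "fst z" "snd z"] norm_snd_le[of "snd z" "fst z"]
      by (intro add_mono norm_bounded_clinear_le[THEN order_trans] assms)
        (auto simp: mult.commute[of "norm z"] intro!: mult_left_mono onorm_nonneg assms)
    finally show ?thesis by (simp add: algebra_simps)
  qed
qed

lemma bounded_clinear_zero_op: "bounded_clinear (\<lambda>_. 0)"
  by (rule bounded_clinearI[of _ 0]) simp_all

lemma positive_op_block_diagonal:
  assumes "positive_op A"
  shows "positive_op (block_op A (\<lambda>_. 0) (\<lambda>_. 0) A)"
  unfolding positive_op_def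
proof
  show "bounded_clinear (block_op A (\<lambda>_. 0) (\<lambda>_. 0) A)"
    using assms by (intro bounded_clinear_block_op bounded_clinear_zero_op) (auto simp: positive_op_def)
qed (use assms in \<open>auto simp: positive_op_def block_op_def cinner_prod_def\<close>)

lemma A_inner_block_diagonal:
  "A_inner (block_op A (\<lambda>_. 0) (\<lambda>_. 0) A) (x, y) (x', y') = A_inner A x x' + A_inner A y y'"
  by (simp add: A_inner_def block_op_def cinner_prod_def)

text \<open>The adjoint of an off-diagonal block operator is off-diagonal with the adjoint entries
  exchanged, so the solutions for the entries, exchanged likewise, solve the block equation.\<close>

lemma block_off_diagonal_in_B_A:
  assumes "S1 \<in> B_A A" "S2 \<in> B_A A"
  shows "block_op (\<lambda>_. 0) S1 S2 (\<lambda>_. 0) \<in> B_A (block_op A (\<lambda>_. 0) (\<lambda>_. 0) A)"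
proof -
  have bc: "bounded_clinear S1" "bounded_clinear S2" using assms by (auto simp: B_A_def)
  obtain R1 R2 where R: "bounded_clinear R1" "A \<circ> R1 = cadjoint S1 \<circ> A"
    "bounded_clinear R2" "A \<circ> R2 = cadjoint S2 \<circ> A"
    using assms by (auto simp: B_A_def)
  have bS: "bounded_clinear (block_op (\<lambda>_. 0) S1 S2 (\<lambda>_. 0))"
    by (intro bounded_clinear_block_op bounded_clinear_zero_op bc)
  have adj: "cadjoint (block_op (\<lambda>_. 0) S1 S2 (\<lambda>_. 0)) (x, y) = (cadjoint S2 y, cadjoint S1 x)" for x y
    by (rule cadjoint_eqI[OF bS])
      (auto simp: block_op_def cinner_prod_def cinner_cadjoint bc add.commute)
  have "block_op A (\<lambda>_. 0) (\<lambda>_. 0) A \<circ> block_op (\<lambda>_. 0) R2 R1 (\<lambda>_. 0)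
      = cadjoint (block_op (\<lambda>_. 0) S1 S2 (\<lambda>_. 0)) \<circ> block_op A (\<lambda>_. 0) (\<lambda>_. 0) A"
  proof
    fix z :: "'a \<times> 'a"
    have "A (R1 x) = cadjoint S1 (A x)" "A (R2 x) = cadjoint S2 (A x)" for x
      using R(2,4) by (metis comp_apply)+
    then show "(block_op A (\<lambda>_. 0) (\<lambda>_. 0) A \<circ> block_op (\<lambda>_. 0) R2 R1 (\<lambda>_. 0)) z
      = (cadjoint (block_op (\<lambda>_. 0) S1 S2 (\<lambda>_. 0)) \<circ> block_op A (\<lambda>_. 0) (\<lambda>_. 0) A) z"
      by (cases z) (simp add: adj block_op_def[of A] block_op_def[of "\<lambda>_. 0" R2])
  qed
  moreover have "bounded_clinear (block_op (\<lambda>_. 0) R2 R1 (\<lambda>_. 0))"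
    by (intro bounded_clinear_block_op bounded_clinear_zero_op R)
  ultimately show ?thesis using bS unfolding B_A_def by blast
qed

text \<open>Vectors of positive \<open>A\<close>-norm are scaled to \<open>A\<close>-norm one. For
  \<open>A\<close>-norm zero, moving \<open>T\<close> across by its \<open>A\<close>-adjoint leaves
  \<open>x\<close> alone in one slot, and Cauchy-Schwarz makes the left side vanish.\<close>

lemma A_inner_homogeneous_le:
  assumes A: "positive_op A" and T: "T \<in> B_A A" and S: "S \<in> B_A A"
    and unit: "\<And>x. A_norm A x = 1 \<Longrightarrow> cmod (A_inner A (T x) (S x)) \<le> c"
  shows "cmod (A_inner A (T x) (S x)) \<le> c * (A_norm A x)\<^sup>2"
proof (cases "A_norm A x = 0")
  case True
  have "A_inner A (T x) (S x) = cnj (A_inner A (A_adjoint A T (S x)) x)"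
    using A_inner_commute[OF A, of "T x" "S x"] by (simp add: A_inner_A_adjoint[OF A T])
  then show ?thesis using cmod_A_inner_le[OF A, of "A_adjoint A T (S x)" x] True by simp
next
  case False
  define n where "n = A_norm A x"
  have n: "n > 0" using False A_norm_nonneg[OF A, of x] by (simp add: n_def)
  have bc: "bounded_clinear A" "bounded_clinear T" "bounded_clinear S"
    using A T S by (auto simp: positive_op_def B_A_def)
  define y where "y = (1 / n) *\<^sub>R x"
  have "A_norm A y = 1" using n by (simp add: y_def A_norm_scaleR[OF A] flip: n_def)
  moreover have "x = n *\<^sub>R y" using n by (simp add: y_def)
  then have "A_inner A (T x) (S x) = of_real (n\<^sup>2) * A_inner A (T y) (S y)"
    by (simp add: A_inner_def bounded_clinear_scaleR[OF bc(1)] bounded_clinear_scaleR[OF bc(2)]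
        bounded_clinear_scaleR[OF bc(3)] cinner_scaleR_left cinner_scaleR_right power2_eq_square)
  ultimately have "cmod (A_inner A (T x) (S x)) \<le> n\<^sup>2 * c"
    using unit[of y] by (simp add: norm_mult norm_power mult_left_mono)
  then show ?thesis by (simp add: n_def mult.commute)
qed

theorem theorem2p34:
  fixes A T1 T2 S1 S2 :: "'a::complex_hilbert_space \<Rightarrow> 'a"
    and \<beta> r :: real
  assumes "positive_op A"
    and "T1 \<in> B_A A" and "T2 \<in> B_A A" and "S1 \<in> B_A A" and "S2 \<in> B_A A"
    and "\<beta> \<ge> 0" and "r \<ge> 1"
  shows "let
      AA = block_op A (\<lambda>_. 0) (\<lambda>_. 0) A;
      TT = block_op (\<lambda>_. 0) T1 T2 (\<lambda>_. 0);
      SS = block_op (\<lambda>_. 0) S1 S2 (\<lambda>_. 0);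
      \<phi> = A_norm_powr_sum A (2 * r) (A_adjoint A T2 \<circ> T2) (A_adjoint A S2 \<circ> S2);
      \<psi> = A_norm_powr_sum A (2 * r) (A_adjoint A T1 \<circ> T1) (A_adjoint A S1 \<circ> S1);
      \<rho> = A_numerical_radius A (A_adjoint A S2 \<circ> S2 \<circ> A_adjoint A T2 \<circ> T2) powr r;
      \<theta> = A_numerical_radius A (A_adjoint A S1 \<circ> S1 \<circ> A_adjoint A T1 \<circ> T1) powr r
    in A_numerical_radius AA (A_adjoint AA SS \<circ> TT) powr (4 * r)
        \<le> (1 + 2 * \<beta>) / (8 * (\<beta> + 1)) * max (\<phi>\<^sup>2) (\<psi>\<^sup>2)
          + 1 / (2 * (\<beta> + 1)) * max (\<rho>\<^sup>2) (\<theta>\<^sup>2)"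
proof -
  note A = assms(1)
  define AA where "AA = block_op A (\<lambda>_. 0) (\<lambda>_. 0) A"
  define TT where "TT = block_op (\<lambda>_. 0) T1 T2 (\<lambda>_. 0)"
  define SS where "SS = block_op (\<lambda>_. 0) S1 S2 (\<lambda>_. 0)"
  define \<phi> where "\<phi> = A_norm_powr_sum A (2 * r) (A_adjoint A T2 \<circ> T2) (A_adjoint A S2 \<circ> S2)"
  define \<psi> where "\<psi> = A_norm_powr_sum A (2 * r) (A_adjoint A T1 \<circ> T1) (A_adjoint A S1 \<circ> S1)"
  define \<rho> where "\<rho> = A_numerical_radius A (A_adjoint A S2 \<circ> S2 \<circ> A_adjoint A T2 \<circ> T2) powr r"
  define \<theta> where "\<theta> = A_numerical_radius A (A_adjoint A S1 \<circ> S1 \<circ> A_adjoint A T1 \<circ> T1) powr r"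
  define k where "k = (1 + 2 * \<beta>) / (8 * (\<beta> + 1))"
  define l where "l = 1 / (2 * (\<beta> + 1))"
  define M where "M = k * max (\<phi>\<^sup>2) (\<psi>\<^sup>2) + l * max (\<rho>\<^sup>2) (\<theta>\<^sup>2)"
  \<comment> \<open>The \<open>4 * r\<close>-th root is taken before the blocks are combined,
    because the estimates for the two blocks add up linearly in the squared \<open>A\<close>-norms
    of the components.\<close>
  define c where "c = M powr (1 / (4 * r))"
  have kl: "0 \<le> k" "0 \<le> l" using assms by (auto simp: k_def l_def)
  have M: "0 \<le> M" "k * \<phi>\<^sup>2 + l * \<rho>\<^sup>2 \<le> M" "k * \<psi>\<^sup>2 + l * \<theta>\<^sup>2 \<le> M"
    unfolding M_def using kl by (auto intro!: add_mono mult_left_mono add_nonneg_nonneg mult_nonneg_nonneg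
        simp: le_max_iff_disj)
  have root: "y \<le> c" if "y powr (4 * r) \<le> M" "0 \<le> y" for y
  proof -
    have "(y powr (4 * r)) powr (1 / (4 * r)) \<le> c"
      unfolding c_def using that assms by (intro powr_mono2) auto
    then show ?thesis using that assms by (simp add: powr_powr)
  qed
  have unit1: "cmod (A_inner A (T1 x) (S1 x)) \<le> c" if "A_norm A x = 1" for x
    using A_inner_powr_le[OF A assms(2,4,6,7) that] M(3)
    by (intro root) (auto simp: k_def l_def \<psi>_def \<theta>_def)
  have unit2: "cmod (A_inner A (T2 x) (S2 x)) \<le> c" if "A_norm A x = 1" for x
    using A_inner_powr_le[OF A assms(3,5,6,7) that] M(2)
    by (intro root) (auto simp: k_def l_def \<phi>_def \<rho>_def)
  have AA: "positive_op AA" unfolding AA_def by (rule positive_op_block_diagonal[OF A])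
  have SS: "SS \<in> B_A AA" unfolding SS_def AA_def by (rule block_off_diagonal_in_B_A[OF assms(4,5)])
  have le: "cmod (A_inner AA ((A_adjoint AA SS \<circ> TT) z) z) \<le> c" if z: "A_norm AA z = 1" for z
  proof -
    obtain x y where xy: "z = (x, y)" by fastforce
    have "of_real ((A_norm AA z)\<^sup>2) = A_inner A x x + A_inner A y y"
      unfolding A_norm_sq[OF AA, symmetric] by (simp add: AA_def xy A_inner_block_diagonal)
    then have one: "(A_norm A x)\<^sup>2 + (A_norm A y)\<^sup>2 = 1"
      unfolding z A_norm_sq[OF A] by (metis of_real_add of_real_eq_iff power_one)
    \<comment> \<open>The defining relation of the adjoint moves \<open>SS\<close> to the other
      slot, which avoids computing the blocks of \<open>A_adjoint AA SS\<close>.\<close>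
    have "A_inner AA ((A_adjoint AA SS \<circ> TT) z) z = A_inner AA (TT z) (SS z)"
      by (simp add: A_inner_A_adjoint[OF AA SS])
    also have "\<dots> = A_inner A (T1 y) (S1 y) + A_inner A (T2 x) (S2 x)"
      by (simp add: xy TT_def SS_def AA_def A_inner_block_diagonal block_op_def[of "\<lambda>_. 0" _ _ "\<lambda>_. 0"])
    also have "cmod \<dots> \<le> c * (A_norm A y)\<^sup>2 + c * (A_norm A x)\<^sup>2"
      by (intro order_trans[OF norm_triangle_ineq] add_mono A_inner_homogeneous_le A assms unit1 unit2)
    also have "\<dots> = c" using one by (simp add: add.commute flip: distrib_left)
    finally show ?thesis .
  qed
  let ?X = "insert 0 {cmod (A_inner AA ((A_adjoint AA SS \<circ> TT) z) z) |z. A_norm AA z = 1}"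
  \<comment> \<open>The inserted \<open>0\<close> obeys the bound because \<open>c\<close> is a
    value of \<open>powr\<close>, hence nonnegative; for \<open>AA = 0\<close> it is the only member
    of the set.\<close>
  have X: "y \<le> c" if "y \<in> ?X" for y using that le by (auto simp: c_def)
  then have "bdd_above ?X" by (rule bdd_aboveI)
  then have "0 \<le> A_numerical_radius AA (A_adjoint AA SS \<circ> TT)"
    unfolding A_numerical_radius_def by (intro cSup_upper) auto
  moreover have "A_numerical_radius AA (A_adjoint AA SS \<circ> TT) \<le> c"
    unfolding A_numerical_radius_def using X by (intro cSup_least) blast+
  ultimately have "A_numerical_radius AA (A_adjoint AA SS \<circ> TT) powr (4 * r) \<le> c powr (4 * r)"
    using assms by (intro powr_mono2) auto
  also have "\<dots> = M" using M(1) assms by (simp add: c_def powr_powr)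
  finally show ?thesis
    unfolding Let_def M_def k_def l_def AA_def TT_def SS_def \<phi>_def \<psi>_def \<rho>_def \<theta>_def .
qed

end
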